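(* Let $(X,\sigma_X)$, $(Y,\sigma_Y)$ be one-sided full shifts and $\pi:X\to Y$ a one-block factor map. Let $\mathcal F=\{\log f_n\}$ be an almost additive potential on $X$ with bounded variation, $\mu_{\mathcal F}\in M(X,\sigma_X)$ its unique invariant Gibbs measure, and $\nu=\pi\mu_{\mathcal F}$. Then $\nu$ is the unique equilibrium state for the function $P(\sigma_X,\pi,\mathcal F)$ on $Y$, i.e. the unique $m\in M(Y,\sigma_Y)$ maximizing $h_m(\sigma_Y)+\int P(\sigma_X,\pi,\mathcal F)\,dm$; and $\mu_{\mathcal F}$ is the unique relative equilibrium state for $\mathcal F$ over $\nu$.
   Context: A full shift is $\{1,\dots,k\}^{\mathbb N}$ with the left shift and metric $d(x,x')=2^{-j}$, $j$ the longest common prefix length. A factor map is a continuous surjection commuting with the shifts; one-block means $\pi(x)_i$ depends only on $x_i$. Almost additive: continuous $f_n>0$ and $\exists C>0$ with $e^{-C}f_n(x)f_m(\sigma_X^nx)\le f_{n+m}(x)\le e^Cf_n(x)f_m(\sigma_X^nx)$; bounded variation: $\sup_n\sup\{f_n(x)/f_n(x'):x_i=x'_i,1\le i\le n\}<\infty$. Gibbs measure: $\exists C_0$ with $C_0^{-1}<\mu([x_1\cdots x_n])/(e^{-nP_X(\mathcal F)}f_n(x))<C_0$ for all $x,n$, $P_X$ the topological pressure. Relative pressure: $P(\sigma_X,\pi,\mathcal F)(y)=\lim_{\epsilon\to0}\limsup_n\frac1n\log\sup\{\sum_{x\in E}f_n(x):E\text{ an }(n,\epsilon)\text{-separated subset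 of }\pi^{-1}\{y\}\}$. A relative equilibrium state for $\mathcal F$ over $m\in M(Y,\sigma_Y)$ is $\bar\mu\in M(X,\sigma_X)$ with $\pi\bar\mu=m$ maximizing $h_{\bar\mu}(\sigma_X)-h_m(\sigma_Y)+\lim_n\frac1n\int\log f_nd\bar\mu$ among all invariant $\bar\mu$ with $\pi\bar\mu=m$. *)

theory Defs
  imports "HOL-Probability.Probability"
begin

text \<open>Points are sequences indexed from 0; the symbol set is {0,...,k-1}
  (the paper's {1,...,k}, shifted by one).  The topology on nat => nat is the
  product topology (HOL-Analysis Function_Topology), which on the full shift
  coincides with the topology of the metric shift_dist below.\<close>

definition fullshift :: "nat \<Rightarrow> (nat \<Rightarrow> nat) set" where
  "fullshift k = {x. \<forall>i. x i < k}"

definition shift :: "(nat \<Rightarrow> nat) \<Rightarrow> (nat \<Rightarrow> nat)" where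
  "shift x = (\<lambda>i. x (Suc i))"

definition shift_dist :: "(nat \<Rightarrow> nat) \<Rightarrow> (nat \<Rightarrow> nat) \<Rightarrow> real" where
  "shift_dist x x' = (if x = x' then 0 else (1/2) ^ (LEAST i. x i \<noteq> x' i))"

definition cyl :: "nat \<Rightarrow> (nat \<Rightarrow> nat) \<Rightarrow> nat \<Rightarrow> (nat \<Rightarrow> nat) set" where
  "cyl k x n = {x' \<in> fullshift k. \<forall>i<n. x' i = x i}"

definition shift_space :: "nat \<Rightarrow> (nat \<Rightarrow> nat) measure" where
  "shift_space k = restrict_space borel (fullshift k)"

definition inv_measures :: "nat \<Rightarrow> (nat \<Rightarrow> nat) measure set" where
  "inv_measures k = {\<mu>. prob_space \<mu> \<and> sets \<mu> = sets (shift_space k) \<and>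
      (\<forall>A \<in> sets \<mu>. emeasure \<mu> (shift -` A \<inter> space \<mu>) = emeasure \<mu> A)}"

definition is_partition :: "'a measure \<Rightarrow> 'a set set \<Rightarrow> bool" where
  "is_partition \<mu> P \<longleftrightarrow> finite P \<and> P \<subseteq> sets \<mu> \<and> \<Union>P = space \<mu> \<and>
      (\<forall>A\<in>P. \<forall>B\<in>P. A \<noteq> B \<longrightarrow> A \<inter> B = {})"

definition part_entropy :: "'a measure \<Rightarrow> 'a set set \<Rightarrow> real" where
  "part_entropy \<mu> P = - (\<Sum>A\<in>P. measure \<mu> A * ln (measure \<mu> A))"

definition join_part :: "'a measure \<Rightarrow> ('a \<Rightarrow> 'a) \<Rightarrow> 'a set set \<Rightarrow> nat \<Rightarrow> 'a set set" where
  "join_part \<mu> T P n =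
     {(\<Inter>i\<in>{..<n}. (T ^^ i) -` (A i)) \<inter> space \<mu> | A. A \<in> {..<n} \<rightarrow> P}"

definition entropy_wrt :: "'a measure \<Rightarrow> ('a \<Rightarrow> 'a) \<Rightarrow> 'a set set \<Rightarrow> real" where
  "entropy_wrt \<mu> T P = lim (\<lambda>n. part_entropy \<mu> (join_part \<mu> T P n) / real n)"

definition ks_entropy :: "'a measure \<Rightarrow> ('a \<Rightarrow> 'a) \<Rightarrow> real" where
  "ks_entropy \<mu> T = Sup {entropy_wrt \<mu> T P | P. is_partition \<mu> P}"

definition almost_additive :: "nat \<Rightarrow> (nat \<Rightarrow> (nat \<Rightarrow> nat) \<Rightarrow> real) \<Rightarrow> bool" where
  "almost_additive k f \<longleftrightarrow>
     (\<forall>n\<ge>1. continuous_on (fullshift k) (f n) \<and> (\<forall>x\<in>fullshift k. f n x > 0)) \<and>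
     (\<exists>C>0. \<forall>n\<ge>1. \<forall>m\<ge>1. \<forall>x\<in>fullshift k.
        exp (-C) * f n x * f m ((shift ^^ n) x) \<le> f (n + m) x \<and>
        f (n + m) x \<le> exp C * f n x * f m ((shift ^^ n) x))"

definition bounded_variation :: "nat \<Rightarrow> (nat \<Rightarrow> (nat \<Rightarrow> nat) \<Rightarrow> real) \<Rightarrow> bool" where
  "bounded_variation k f \<longleftrightarrow>
     (\<exists>B. \<forall>n\<ge>1. \<forall>x\<in>fullshift k. \<forall>x'\<in>fullshift k.
        (\<forall>i<n. x i = x' i) \<longrightarrow> f n x / f n x' \<le> B)"

definition separated :: "nat \<Rightarrow> real \<Rightarrow> (nat \<Rightarrow> nat) set \<Rightarrow> bool" where
  "separated n \<epsilon> E \<longleftrightarrow> (\<forall>x\<in>E. \<forall>x'\<in>E. x \<noteq> x' \<longrightarrow>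
      (\<exists>i<n. shift_dist ((shift ^^ i) x) ((shift ^^ i) x') > \<epsilon>))"

definition pressure_eps :: "(nat \<Rightarrow> (nat \<Rightarrow> nat) \<Rightarrow> real) \<Rightarrow> (nat \<Rightarrow> nat) set \<Rightarrow> real \<Rightarrow> ereal" where
  "pressure_eps f Z \<epsilon> = limsup (\<lambda>n. ereal (ln (Sup {\<Sum>x\<in>E. f n x | E. finite E \<and> E \<subseteq> Z \<and> separated n \<epsilon> E}) / real n))"

definition sep_pressure :: "(nat \<Rightarrow> (nat \<Rightarrow> nat) \<Rightarrow> real) \<Rightarrow> (nat \<Rightarrow> nat) set \<Rightarrow> real" where
  "sep_pressure f Z = real_of_ereal (Lim (at_right 0) (pressure_eps f Z))"

definition top_pressure :: "nat \<Rightarrow> (nat \<Rightarrow> (nat \<Rightarrow> nat) \<Rightarrow> real) \<Rightarrow> real" where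
  "top_pressure k f = sep_pressure f (fullshift k)"

definition rel_pressure :: "nat \<Rightarrow> ((nat \<Rightarrow> nat) \<Rightarrow> (nat \<Rightarrow> nat)) \<Rightarrow> (nat \<Rightarrow> (nat \<Rightarrow> nat) \<Rightarrow> real)
      \<Rightarrow> (nat \<Rightarrow> nat) \<Rightarrow> real" where
  "rel_pressure k \<pi> f y = sep_pressure f (fullshift k \<inter> \<pi> -` {y})"

definition gibbs :: "nat \<Rightarrow> (nat \<Rightarrow> (nat \<Rightarrow> nat) \<Rightarrow> real) \<Rightarrow> (nat \<Rightarrow> nat) measure \<Rightarrow> bool" where
  "gibbs k f \<mu> \<longleftrightarrow> (\<exists>C0>0. \<forall>x\<in>fullshift k. \<forall>n\<ge>1.
      inverse C0 < measure \<mu> (cyl k x n) / (exp (- real n * top_pressure k f) * f n x) \<and>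
      measure \<mu> (cyl k x n) / (exp (- real n * top_pressure k f) * f n x) < C0)"

definition one_block_factor :: "nat \<Rightarrow> nat \<Rightarrow> ((nat \<Rightarrow> nat) \<Rightarrow> (nat \<Rightarrow> nat)) \<Rightarrow> bool" where
  "one_block_factor k l \<pi> \<longleftrightarrow>
     continuous_on (fullshift k) \<pi> \<and> \<pi> ` fullshift k = fullshift l \<and>
     (\<forall>x\<in>fullshift k. \<pi> (shift x) = shift (\<pi> x)) \<and>
     (\<exists>p. \<forall>x\<in>fullshift k. \<forall>i. \<pi> x i = p (x i))"

definition push :: "nat \<Rightarrow> ((nat \<Rightarrow> nat) \<Rightarrow> (nat \<Rightarrow> nat)) \<Rightarrow> (nat \<Rightarrow> nat) measure \<Rightarrow> (nat \<Rightarrow> nat) measure" where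
  "push l \<pi> \<mu> = distr \<mu> (shift_space l) \<pi>"

definition is_unique_equilibrium :: "nat \<Rightarrow> ((nat \<Rightarrow> nat) \<Rightarrow> real) \<Rightarrow> (nat \<Rightarrow> nat) measure \<Rightarrow> bool" where
  "is_unique_equilibrium l \<phi> m \<longleftrightarrow> m \<in> inv_measures l \<and>
     (\<forall>m'\<in>inv_measures l.
        ks_entropy m' shift + (\<integral>y. \<phi> y \<partial>m') \<le> ks_entropy m shift + (\<integral>y. \<phi> y \<partial>m)) \<and>
     (\<forall>m'\<in>inv_measures l.
        ks_entropy m' shift + (\<integral>y. \<phi> y \<partial>m') = ks_entropy m shift + (\<integral>y. \<phi> y \<partial>m) \<longrightarrow> m' = m)"

definition rel_free_energy :: "(nat \<Rightarrow> (nat \<Rightarrow> nat) \<Rightarrow> real) \<Rightarrow> (nat \<Rightarrow> nat) measure \<Rightarrow> (nat \<Rightarrow> nat) measure \<Rightarrow> real" where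
  "rel_free_energy f m \<mu> = ks_entropy \<mu> shift - ks_entropy m shift +
      lim (\<lambda>n. (\<integral>x. ln (f n x) \<partial>\<mu>) / real n)"

definition is_unique_rel_equilibrium :: "nat \<Rightarrow> nat \<Rightarrow> ((nat \<Rightarrow> nat) \<Rightarrow> (nat \<Rightarrow> nat)) \<Rightarrow>
      (nat \<Rightarrow> (nat \<Rightarrow> nat) \<Rightarrow> real) \<Rightarrow> (nat \<Rightarrow> nat) measure \<Rightarrow> (nat \<Rightarrow> nat) measure \<Rightarrow> bool" where
  "is_unique_rel_equilibrium k l \<pi> f m \<mu> \<longleftrightarrow> \<mu> \<in> inv_measures k \<and> push l \<pi> \<mu> = m \<and>
     (\<forall>\<mu>'\<in>inv_measures k. push l \<pi> \<mu>' = m \<longrightarrow> rel_free_energy f m \<mu>' \<le> rel_free_energy f m \<mu>) \<and>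
     (\<forall>\<mu>'\<in>inv_measures k. push l \<pi> \<mu>' = m \<longrightarrow>
        rel_free_energy f m \<mu>' = rel_free_energy f m \<mu> \<longrightarrow> \<mu>' = \<mu>)"

end

theory Submission
  imports Defs
begin

text \<open>The Gibbs property replaces \<open>f\<^sub>n\<close>, up to bounded factors and \<open>exp (n P)\<close>, by the
  \<open>\<mu>\<close>-measure of \<open>n\<close>-cylinders, and almost additivity makes \<open>\<mu>\<close> quasi-Bernoulli:
  \<open>\<mu>[uv]\<close> and \<open>\<mu>[u] \<mu>[v]\<close> are comparable.  Since \<open>\<pi>\<close> maps letters to letters, \<open>\<nu> = \<pi>\<mu>\<close> is
  quasi-Bernoulli as well, and the relative pressure at \<open>y\<close> is
  \<open>P + limsup (1/n) ln \<nu>[y\<^sub>1 \<dots> y\<^sub>n]\<close>.  Both claims are therefore instances of one variational principle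
  for a quasi-Bernoulli measure \<open>\<mu>\<close>: the entropy of an invariant \<open>\<mu>'\<close> plus
  \<open>lim (1/n) \<integral> ln \<mu>[x\<^sub>1 \<dots> x\<^sub>n] d\<mu>'\<close> equals \<open>- lim D\<^sub>n / n\<close>, where \<open>D\<^sub>n \<ge> 0\<close> is the relative entropy of
  \<open>\<mu>'\<close> with respect to \<open>\<mu>\<close> on \<open>n\<close>-words.  As \<open>D\<^sub>n\<close> is superadditive up to a constant, a zero limit
  bounds \<open>D\<^sub>n\<close>; this forces \<open>\<mu>'\<close> to be absolutely continuous with respect to the ergodic measure \<open>\<mu>\<close>, and
  comparing frequencies of words gives \<open>\<mu>' = \<mu>\<close>.\<close>

section \<open>Subadditive sequences and entropy of finite-valued maps\<close>

text \<open>The pressure function on \<open>Y\<close> is an upper limit taken point by point and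
  then integrated, while entropy and \<open>rel_free_energy\<close> are limits of integrals. An
  integrated ergodic theorem is enough to pass between them: the integral of the upper average of an
  almost additive cocycle is the limit of the averaged integrals. It serves twice, for logarithms of
  cylinder masses and for word frequencies. In the second use the frequency depends on the point
  alone, so one and the same function is integrated against both measures.

  \<open>ks_entropy\<close> is a supremum over all finite partitions and has to be identified with
  the growth rate of word entropies before words can be compared. Here, as in most entropy bounds,
  Gibbs' inequality is applied with a comparison weight made for the purpose.

  A zero rate bounds \<open>D\<^sub>n\<close> because the limit in Fekete's lemma is an infimum. In
  the relative statement the entropy of \<nu> enters only as an additive constant.\<close>

text \<open>Adding \<open>C\<close> makes the sequence truly subadditive, so its rate is an infimum.
  The infimum property is kept as the second conclusion because it later turns a vanishing limit
  into a bound at every \<open>n\<close>.\<close>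

lemma fekete:
  fixes a :: "nat \<Rightarrow> real"
  assumes sub: "\<And>n m. a (n + m) \<le> a n + a m + C" and low: "\<And>n. - K * real n \<le> a n"
  obtains l where "(\<lambda>n. a n / real n) \<longlonglongrightarrow> l" and "\<And>n. n \<ge> 1 \<Longrightarrow> l \<le> (a n + C) / real n"
proof -
  define b where "b n = a n + C" for n
  define S where "S = {b n / real n | n. n \<ge> 1}"
  define l where "l = Inf S"
  have bdd: "bdd_below S"
  proof (rule bdd_belowI[of _ "- K - \<bar>C\<bar>"])
    fix s assume "s \<in> S"
    then obtain n where n: "n \<ge> 1" "s = b n / real n" by (auto simp: S_def)
    have "\<bar>C\<bar> \<le> \<bar>C\<bar> * real n" using n(1) mult_left_mono[of 1 "real n" "\<bar>C\<bar>"] by simp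
    then have "(- K - \<bar>C\<bar>) * real n \<le> b n"
      using low[of n] unfolding b_def by (simp add: algebra_simps)
    then have "- K - \<bar>C\<bar> \<le> b n / real n" using n(1) by (subst pos_le_divide_eq) auto
    then show "- K - \<bar>C\<bar> \<le> s" using n(2) by simp
  qed
  have lb: "l \<le> b n / real n" if "n \<ge> 1" for n
    unfolding l_def by (rule cInf_lower[OF _ bdd]) (use that in \<open>auto simp: S_def\<close>)
  have mult: "b (q * N + r) \<le> real q * b N + b r" for q N r
  proof (induction q)
    case (Suc q)
    have "b (Suc q * N + r) = b (N + (q * N + r))" by (simp add: algebra_simps)
    also have "\<dots> \<le> b N + b (q * N + r)" using sub[of N "q * N + r"] by (simp add: b_def)
    finally show ?case using Suc by (simp add: algebra_simps)
  qed simp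
  have "(\<lambda>n. b n / real n) \<longlonglongrightarrow> l"
  proof (rule LIMSEQ_I)
    fix e :: real assume e: "0 < e"
    have "\<exists>s\<in>S. s < l + e / 2"
      using e bdd by (intro cInf_lessD) (auto simp: S_def l_def)
    then obtain N where N: "N \<ge> 1" "b N / real N < l + e / 2" by (auto simp: S_def)
    define v where "v = b N / real N"
    \<comment> \<open>With \<open>n = q N + r\<close>, the constant \<open>D\<close> absorbs the
      finitely many remainders, so \<open>b n\<close> exceeds \<open>n v\<close> by a bounded amount
      at most.\<close>
    define D where "D = Max ((\<lambda>r. \<bar>b r - real r * v\<bar>) ` {..<N})"
    have D: "b r - real r * v \<le> D" if "r < N" for r
      unfolding D_def by (rule order_trans[OF abs_ge_self Max_ge]) (use that in auto)
    have up: "b n \<le> real n * v + D" for n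
    proof -
      have "b n \<le> real (n div N) * b N + b (n mod N)" using mult[of "n div N" N "n mod N"] by simp
      also have "real (n div N) * b N = (real n - real (n mod N)) * v"
      proof -
        have "real n = real (n div N) * real N + real (n mod N)"
          by (metis div_mult_mod_eq of_nat_add of_nat_mult)
        then show ?thesis using N(1) by (simp add: v_def)
      qed
      finally show ?thesis using D[of "n mod N"] N(1) by (simp add: algebra_simps)
    qed
    obtain n0 :: nat where n0: "real n0 > 2 * D / e" using reals_Archimedean2 by blast
    have "norm (b n / real n - l) < e" if n: "n \<ge> max 1 n0" for n
    proof -
      have "2 * D < e * real n" using n0 n e by (simp add: field_simps) (smt (verit) mult_left_mono of_nat_mono)
      then have "b n < real n * (v + e / 2)" using up[of n] by (simp add: algebra_simps)
      also have "\<dots> < real n * (l + e)" using N n by (simp add: v_def)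
      finally have "b n / real n < l + e" using n by (simp add: field_simps)
      then show ?thesis using lb[of n] n by simp
    qed
    then show "\<exists>no. \<forall>n\<ge>no. norm (b n / real n - l) < e" by blast
  qed
  moreover have "(\<lambda>n. C / real n) \<longlonglongrightarrow> 0" by (rule lim_const_over_n)
  ultimately have "(\<lambda>n. b n / real n - C / real n) \<longlonglongrightarrow> l - 0" by (rule tendsto_diff)
  then have "(\<lambda>n. a n / real n) \<longlonglongrightarrow> l" by (simp add: b_def diff_divide_distrib[symmetric])
  then show thesis using that lb by (auto simp: b_def)
qed

section \<open>Shannon entropy of finite-valued maps and Gibbs' inequality\<close>

definition fib :: "'a measure \<Rightarrow> ('a \<Rightarrow> 'b) \<Rightarrow> 'b \<Rightarrow> real" where
  "fib M X s = measure M {z \<in> space M. X z = s}"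

text \<open>Shannon entropy as the integral of the information function, so that decompositions can
  be proved pointwise. Values of probability zero occur only on a null set.\<close>

definition ent :: "'a measure \<Rightarrow> ('a \<Rightarrow> 'b) \<Rightarrow> real" where
  "ent M X = (\<integral>x. - ln (fib M X (X x)) \<partial>M)"

context prob_space
begin

lemma simple_function_fibre [measurable]:
  assumes "simple_function M X"
  shows "{z \<in> space M. X z = s} \<in> sets M"
proof -
  have "{z \<in> space M. X z = s} = X -` {s} \<inter> space M" by auto
  then show ?thesis using simple_functionD(2)[OF assms] by simp
qed

lemma fib_nonneg: "0 \<le> fib M X s" by (simp add: fib_def)

lemma fib_le_1: "fib M X s \<le> 1" by (simp add: fib_def)

lemma integrable_simple_comp:
  fixes g :: "'b \<Rightarrow> real"
  assumes "simple_function M X"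
  shows "integrable M (\<lambda>x. g (X x))"
  using simple_function_compose[OF assms, of g]
  by (intro integrable_simple_function) (auto simp: comp_def emeasure_eq_measure)

lemma integral_simple_comp:
  fixes g :: "'b \<Rightarrow> real"
  assumes X: "simple_function M X"
  shows "(\<integral>x. g (X x) \<partial>M) = (\<Sum>s\<in>X ` space M. g s * fib M X s)"
proof -
  have fin: "finite (X ` space M)" using X by (rule simple_functionD)
  have "(\<integral>x. g (X x) \<partial>M) = (\<integral>x. (\<Sum>s\<in>X ` space M. g s * indicator {z \<in> space M. X z = s} x) \<partial>M)"
  proof (rule Bochner_Integration.integral_cong[OF refl])
    fix x assume x: "x \<in> space M"
    have "(\<Sum>s\<in>X ` space M. g s * indicator {z \<in> space M. X z = s} x)
        = (\<Sum>s\<in>X ` space M. if s = X x then g s else 0)"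
      using x by (intro sum.cong) auto
    also have "\<dots> = g (X x)" using fin x by simp
    finally show "g (X x) = (\<Sum>s\<in>X ` space M. g s * indicator {z \<in> space M. X z = s} x)" ..
  qed
  also have "\<dots> = (\<Sum>s\<in>X ` space M. g s * fib M X s)"
    using simple_function_fibre[OF X]
    by (subst Bochner_Integration.integral_sum) (auto simp: fib_def emeasure_eq_measure)
  finally show ?thesis .
qed

lemma sum_fib:
  assumes "simple_function M X"
  shows "(\<Sum>s\<in>X ` space M. fib M X s) = 1"
  using integral_simple_comp[OF assms, of "\<lambda>_. 1"] by (simp add: prob_space)

lemma AE_fib_pos:
  assumes X: "simple_function M X"
  shows "AE x in M. 0 < fib M X (X x)"
proof -
  have "AE x in M. X x = s \<longrightarrow> 0 < fib M X s" for s
  proof (cases "fib M X s = 0")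
    case True
    then have "{z \<in> space M. X z = s} \<in> null_sets M"
      using simple_function_fibre[OF X] by (auto simp: fib_def emeasure_eq_measure)
    then have "AE x in M. x \<notin> {z \<in> space M. X z = s}" by (rule AE_not_in)
    then show ?thesis by (rule AE_mp) (auto intro!: AE_I2)
  next
    case False
    then show ?thesis using fib_nonneg[of X s] by simp
  qed
  then have "AE x in M. \<forall>s\<in>X ` space M. X x = s \<longrightarrow> 0 < fib M X s"
    using simple_functionD(1)[OF X] by (subst AE_finite_all) auto
  then show ?thesis by (rule AE_mp) (auto intro!: AE_I2)
qed

lemma ent_eq_sum:
  assumes X: "simple_function M X"
  shows "ent M X = - (\<Sum>s\<in>X ` space M. fib M X s * ln (fib M X s))"
  using integral_simple_comp[OF X, of "\<lambda>s. - ln (fib M X s)"]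
  by (simp add: ent_def sum_negf mult.commute)

lemma ent_nonneg: "0 \<le> ent M X"
proof -
  have "ln (fib M X s) \<le> 0" for s
    using fib_nonneg[of X s] fib_le_1[of X s] by (cases "fib M X s = 0") auto
  then show ?thesis unfolding ent_def by (intro Bochner_Integration.integral_nonneg) simp
qed

text \<open>Gibbs' inequality: summing \<open>ln t \<le> t - 1\<close> for
  \<open>t = q s / fib M X s\<close>, weighted by \<open>fib M X s\<close>, leaves a difference of
  total masses that is at most 0. Subadditivity, the generator estimate and the bounds on relative
  entropy are instances with different \<open>q\<close>.\<close>

lemma ent_le_cross:
  assumes X: "simple_function M X" and q: "\<And>s. s \<in> X ` space M \<Longrightarrow> 0 \<le> q s"
    and sum: "(\<Sum>s\<in>X ` space M. q s) \<le> 1"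
    and pos: "\<And>s. s \<in> X ` space M \<Longrightarrow> 0 < fib M X s \<Longrightarrow> 0 < q s"
  shows "ent M X \<le> (\<integral>x. - ln (q (X x)) \<partial>M)"
proof -
  have "(\<Sum>s\<in>X ` space M. fib M X s * ln (q s) - fib M X s * ln (fib M X s))
      \<le> (\<Sum>s\<in>X ` space M. q s - fib M X s)"
  proof (rule sum_mono)
    fix s assume s: "s \<in> X ` space M"
    show "fib M X s * ln (q s) - fib M X s * ln (fib M X s) \<le> q s - fib M X s"
    proof (cases "fib M X s = 0")
      case False
      then have p: "0 < fib M X s" using fib_nonneg[of X s] by simp
      have "ln (q s / fib M X s) \<le> q s / fib M X s - 1"
        using p pos[OF s p] by (intro ln_le_minus_one) simp
      then have "fib M X s * (ln (q s) - ln (fib M X s)) \<le> fib M X s * (q s / fib M X s - 1)"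
        using p pos[OF s p] by (simp add: ln_div)
      then show ?thesis using p by (simp add: algebra_simps)
    qed (use q[OF s] in simp)
  qed
  also have "\<dots> \<le> 0" using sum sum_fib[OF X] by (simp add: sum_subtractf)
  finally show ?thesis
    using integral_simple_comp[OF X, of "\<lambda>s. - ln (q s)"]
    by (simp add: ent_eq_sum[OF X] sum_subtractf sum_negf mult.commute)
qed

text \<open>The fibre of \<open>Z\<close> through a point lies inside the fibre of the coarser map,
  so coarsening lowers the information almost everywhere.\<close>

lemma ent_comp_le:
  assumes Z: "simple_function M Z"
  shows "ent M (\<lambda>x. h (Z x)) \<le> ent M Z"
  unfolding ent_def
proof (rule integral_mono_AE)
  show "integrable M (\<lambda>x. - ln (fib M (\<lambda>x. h (Z x)) (h (Z x))))"
    using integrable_simple_comp[OF Z, of "\<lambda>z. - ln (fib M (\<lambda>x. h (Z x)) (h z))"] .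
  show "integrable M (\<lambda>x. - ln (fib M Z (Z x)))"
    using integrable_simple_comp[OF Z, of "\<lambda>z. - ln (fib M Z z)"] .
  have hZ: "simple_function M (\<lambda>x. h (Z x))"
    using simple_function_compose[OF Z, of h] by (simp add: comp_def)
  have "fib M Z (Z x) \<le> fib M (\<lambda>x. h (Z x)) (h (Z x))" for x
    unfolding fib_def using simple_function_fibre[OF hZ] by (intro finite_measure_mono) auto
  then show "AE x in M. - ln (fib M (\<lambda>x. h (Z x)) (h (Z x))) \<le> - ln (fib M Z (Z x))"
    using AE_fib_pos[OF Z] by (auto elim!: eventually_mono simp: ln_le_cancel_iff order_less_le_trans)
qed

end

section \<open>Itineraries under a measure-preserving map\<close>

definition itin :: "('a \<Rightarrow> 'a) \<Rightarrow> ('a \<Rightarrow> 'b) \<Rightarrow> nat \<Rightarrow> 'a \<Rightarrow> 'b list" where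
  "itin T X n x = map (\<lambda>i. X ((T ^^ i) x)) [0..<n]"

lemma length_itin [simp]: "length (itin T X n x) = n"
  by (simp add: itin_def)

lemma itin_0 [simp]: "itin T X 0 x = []"
  by (simp add: itin_def)

lemma itin_Suc: "itin T X (Suc n) x = itin T X n x @ [X ((T ^^ n) x)]"
  by (simp add: itin_def)

lemma itin_add: "itin T X (n + m) x = itin T X n x @ itin T X m ((T ^^ n) x)"
proof (induction m)
  case (Suc m)
  have "(T ^^ (n + m)) x = (T ^^ m) ((T ^^ n) x)"
    by (simp add: add.commute funpow_add)
  then show ?case using Suc by (simp add: itin_Suc)
qed simp

lemma itin_eq_iff: "itin T X n x = itin T X n z \<longleftrightarrow> (\<forall>i<n. X ((T ^^ i) x) = X ((T ^^ i) z))"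
  by (auto simp: itin_def map_eq_conv)

lemma nth_itin: "i < n \<Longrightarrow> itin T X n x ! i = X ((T ^^ i) x)"
  by (simp add: itin_def)

locale mpt = prob_space M for M :: "'a measure" +
  fixes T :: "'a \<Rightarrow> 'a"
  assumes T: "T \<in> M \<rightarrow>\<^sub>M M" and distr_T: "distr M M T = M"
begin

lemma funpow_measurable: "T ^^ n \<in> M \<rightarrow>\<^sub>M M"
proof (induction n)
  case (Suc n)
  show ?case using measurable_comp[OF Suc T] by (simp add: comp_def)
qed simp

lemma funpow_space: "x \<in> space M \<Longrightarrow> (T ^^ n) x \<in> space M"
  using funpow_measurable by (rule measurable_space)

lemma distr_funpow: "distr M M (T ^^ n) = M"
proof (induction n)
  case 0
  show ?case by (simp add: id_def distr_id)
next
  case (Suc n)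
  have "distr M M (T ^^ Suc n) = distr (distr M M (T ^^ n)) M T"
    by (simp add: distr_distr[OF T funpow_measurable])
  then show ?case by (simp only: Suc distr_T)
qed

lemma mpt_funpow: "mpt M (T ^^ n)"
  by unfold_locales (use funpow_measurable distr_funpow in auto)

lemma integral_funpow:
  fixes g :: "'a \<Rightarrow> real"
  assumes "g \<in> borel_measurable M"
  shows "(\<integral>x. g ((T ^^ n) x) \<partial>M) = (\<integral>x. g x \<partial>M)"
  using integral_distr[OF funpow_measurable[of n] assms] by (simp add: distr_funpow)

lemma measure_funpow:
  assumes "A \<in> sets M"
  shows "measure M {x \<in> space M. (T ^^ n) x \<in> A} = measure M A"
proof -
  have "measure (distr M M (T ^^ n)) A = measure M ((T ^^ n) -` A \<inter> space M)"
    by (rule measure_distr[OF funpow_measurable assms])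
  moreover have "(T ^^ n) -` A \<inter> space M = {x \<in> space M. (T ^^ n) x \<in> A}" by auto
  ultimately show ?thesis by (simp add: distr_funpow)
qed

lemma simple_function_funpow:
  "simple_function M X \<Longrightarrow> simple_function M (\<lambda>x. X ((T ^^ n) x))"
  by (rule simple_function_comp[OF funpow_measurable])

lemma simple_function_itin:
  assumes "simple_function M X"
  shows "simple_function M (itin T X n)"
proof (induction n)
  case 0
  show ?case by (simp add: itin_def)
next
  case (Suc n)
  show ?case unfolding itin_Suc
    by (rule simple_function_compose2[OF Suc simple_function_funpow[OF assms]])
qed

lemma fib_itin_funpow:
  assumes "simple_function M X"
  shows "fib M (\<lambda>x. itin T X m ((T ^^ n) x)) w = fib M (itin T X m) w"
proof -
  have "{z \<in> space M. itin T X m ((T ^^ n) z) = w}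
      = {z \<in> space M. (T ^^ n) z \<in> {z \<in> space M. itin T X m z = w}}"
    using funpow_space by auto
  then show ?thesis
    using measure_funpow[OF simple_function_fibre[OF simple_function_itin[OF assms]]]
    by (simp add: fib_def)
qed

lemma AE_fib_itin_funpow:
  assumes "simple_function M X"
  shows "AE x in M. 0 < fib M (itin T X m) (itin T X m ((T ^^ n) x))"
  using AE_fib_pos[OF simple_function_funpow[OF simple_function_itin[OF assms]]]
  by (simp add: fib_itin_funpow[OF assms])

text \<open>Gibbs' inequality against the product of the laws of the two blocks. By invariance the
  block read from time \<open>n\<close> has the law of the initial block of length
  \<open>m\<close>.\<close>

lemma ent_itin_subadditive:
  assumes X: "simple_function M X"
  shows "ent M (itin T X (n + m)) \<le> ent M (itin T X n) + ent M (itin T X m)"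
proof -
  let ?R = "\<lambda>n. itin T X n ` space M"
  let ?q = "\<lambda>w. fib M (itin T X n) (take n w) * fib M (itin T X m) (drop n w)"
  note sf = simple_function_itin[OF X]
  have fin: "finite (?R j)" for j using sf by (rule simple_functionD)
  have td: "take n (itin T X (n + m) x) = itin T X n x" "drop n (itin T X (n + m) x) = itin T X m ((T ^^ n) x)"
    for x by (simp_all add: itin_add)
  have "ent M (itin T X (n + m)) \<le> (\<integral>x. - ln (?q (itin T X (n + m) x)) \<partial>M)"
  proof (rule ent_le_cross[OF sf])
    have "inj_on (\<lambda>w. (take n w, drop n w)) (?R (n + m))"
      by (rule inj_onI) (metis append_take_drop_id prod.inject)
    then have "(\<Sum>w\<in>?R (n + m). ?q w)
        = (\<Sum>(u, v)\<in>(\<lambda>w. (take n w, drop n w)) ` ?R (n + m). fib M (itin T X n) u * fib M (itin T X m) v)"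
      by (simp add: sum.reindex)
    also have "\<dots> \<le> (\<Sum>(u, v)\<in>?R n \<times> ?R m. fib M (itin T X n) u * fib M (itin T X m) v)"
      using fin funpow_space by (intro sum_mono2) (auto simp: td fib_nonneg)
    also have "\<dots> = (\<Sum>u\<in>?R n. fib M (itin T X n) u) * (\<Sum>v\<in>?R m. fib M (itin T X m) v)"
      by (simp add: sum_product sum.cartesian_product)
    also have "\<dots> = 1" using sum_fib[OF sf] by simp
    finally show "(\<Sum>w\<in>?R (n + m). ?q w) \<le> 1" .
  next
    fix w assume w: "w \<in> ?R (n + m)" and p: "0 < fib M (itin T X (n + m)) w"
    have "fib M (itin T X (n + m)) w \<le> fib M (itin T X n) (take n w)"
      unfolding fib_def by (intro finite_measure_mono simple_function_fibre[OF sf]) (auto simp: td)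
    moreover have "fib M (itin T X (n + m)) w \<le> fib M (\<lambda>x. itin T X m ((T ^^ n) x)) (drop n w)"
      unfolding fib_def
      by (intro finite_measure_mono simple_function_fibre[OF simple_function_funpow[OF sf]]) (auto simp: td)
    ultimately show "0 < ?q w" using p by (simp add: fib_itin_funpow[OF X])
  qed (simp add: fib_nonneg)
  also have "\<dots> = (\<integral>x. - ln (fib M (itin T X n) (itin T X n x))
      + - ln (fib M (itin T X m) (itin T X m ((T ^^ n) x))) \<partial>M)"
  proof (rule integral_cong_AE)
    show "(\<lambda>x. - ln (?q (itin T X (n + m) x))) \<in> borel_measurable M"
      using integrable_simple_comp[OF sf, of "\<lambda>w. - ln (?q w)"] by (rule borel_measurable_integrable)
    show "(\<lambda>x. - ln (fib M (itin T X n) (itin T X n x))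
      + - ln (fib M (itin T X m) (itin T X m ((T ^^ n) x)))) \<in> borel_measurable M"
      using integrable_simple_comp[OF sf, of "\<lambda>w. - ln (fib M (itin T X n) w)"]
        integrable_simple_comp[OF simple_function_funpow[OF sf], of "\<lambda>w. - ln (fib M (itin T X m) w)"]
      by (intro borel_measurable_add borel_measurable_integrable) auto
    show "AE x in M. - ln (?q (itin T X (n + m) x)) = - ln (fib M (itin T X n) (itin T X n x))
      + - ln (fib M (itin T X m) (itin T X m ((T ^^ n) x)))"
      using AE_fib_pos[OF sf, of n] AE_fib_itin_funpow[OF X, of m n]
      by eventually_elim (simp add: td ln_mult)
  qed
  also have "\<dots> = ent M (itin T X n) + ent M (itin T X m)"
  proof -
    have i: "integrable M (\<lambda>x. - ln (fib M (itin T X j) (itin T X j x)))" for j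
      using integrable_simple_comp[OF sf, of "\<lambda>w. - ln (fib M (itin T X j) w)"] .
    have "integrable M (\<lambda>x. - ln (fib M (itin T X m) (itin T X m ((T ^^ n) x))))"
      using integrable_simple_comp[OF simple_function_funpow[OF sf], of "\<lambda>w. - ln (fib M (itin T X m) w)"] .
    then show ?thesis
      using i[of n] integral_funpow[OF borel_measurable_integrable[OF i[of m]], of n]
      by (simp only: Bochner_Integration.integral_add ent_def)
  qed
  finally show ?thesis .
qed

lemma ent_rate:
  assumes X: "simple_function M X"
  obtains h where "(\<lambda>n. ent M (itin T X n) / real n) \<longlonglongrightarrow> h"
proof -
  have "ent M (itin T X (n + m)) \<le> ent M (itin T X n) + ent M (itin T X m) + 0" for n m
    using ent_itin_subadditive[OF X] by simp
  moreover have "- 0 * real n \<le> ent M (itin T X n)" for n using ent_nonneg by simp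
  ultimately show thesis by (rule fekete) (rule that)
qed

text \<open>By \<open>sep\<close>, the map \<open>X\<close> and the partition distinguish the same
  points, so the nonempty cells of the join are exactly the fibres of the itinerary map.\<close>

lemma part_entropy_join_part:
  assumes P: "is_partition M P" and X: "simple_function M X"
    and sep: "\<And>x z. x \<in> space M \<Longrightarrow> z \<in> space M \<Longrightarrow> X x = X z \<longleftrightarrow> (\<forall>A\<in>P. x \<in> A \<longleftrightarrow> z \<in> A)"
  shows "part_entropy M (join_part M T P n) = ent M (itin T X n)"
proof -
  let ?J = "join_part M T P n"
  let ?F = "\<lambda>w. {z \<in> space M. itin T X n z = w}"
  have cell: "\<exists>A\<in>P. x \<in> A" if "x \<in> space M" for x using P that by (auto simp: is_partition_def)
  have cell_eq: "X x = X z \<longleftrightarrow> z \<in> A" if "x \<in> space M" "z \<in> space M" "A \<in> P" "x \<in> A" for x z A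
    using sep[OF that(1,2)] P that unfolding is_partition_def by blast
  \<comment> \<open>Choices of cells with empty intersection put the empty set into the join; having
    measure 0, it adds nothing to the entropy.\<close>
  have J: "?J - {{}} = ?F ` (itin T X n ` space M)"
  proof (intro equalityI subsetI)
    fix C assume C: "C \<in> ?J - {{}}"
    then obtain A where A: "A \<in> {..<n} \<rightarrow> P" and Ceq: "C = (\<Inter>i\<in>{..<n}. (T ^^ i) -` A i) \<inter> space M"
      by (auto simp: join_part_def)
    obtain x where x: "x \<in> C" using C by auto
    have "z \<in> C \<longleftrightarrow> z \<in> ?F (itin T X n x)" for z
    proof (cases "z \<in> space M")
      case True
      have "X ((T ^^ i) x) = X ((T ^^ i) z) \<longleftrightarrow> (T ^^ i) z \<in> A i" if "i < n" for i
        using x A that True funpow_space by (intro cell_eq) (auto simp: Ceq)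
      then show ?thesis using True by (auto simp: Ceq itin_eq_iff eq_commute[of "itin T X n z"])
    qed (simp add: Ceq)
    then have "C = ?F (itin T X n x)" by blast
    then show "C \<in> ?F ` (itin T X n ` space M)" using x by (auto simp: Ceq)
  next
    fix C assume "C \<in> ?F ` (itin T X n ` space M)"
    then obtain x where x: "x \<in> space M" "C = ?F (itin T X n x)" by auto
    define A where "A i = (SOME B. B \<in> P \<and> (T ^^ i) x \<in> B)" for i
    have A: "A i \<in> P \<and> (T ^^ i) x \<in> A i" for i
      unfolding A_def by (rule someI_ex) (use cell[OF funpow_space[OF x(1)]] in blast)
    have "z \<in> C \<longleftrightarrow> z \<in> (\<Inter>i\<in>{..<n}. (T ^^ i) -` A i) \<inter> space M" for z
    proof (cases "z \<in> space M")
      case True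
      have "X ((T ^^ i) z) = X ((T ^^ i) x) \<longleftrightarrow> (T ^^ i) z \<in> A i" for i
        using cell_eq[OF funpow_space[OF x(1)] funpow_space[OF True] conjunct1[OF A] conjunct2[OF A]]
        by (auto simp: eq_commute)
      then show ?thesis using True by (auto simp: x(2) itin_eq_iff)
    qed (simp add: x(2))
    then have "C = (\<Inter>i\<in>{..<n}. (T ^^ i) -` A i) \<inter> space M" by blast
    moreover have "A \<in> {..<n} \<rightarrow> P" using A by simp
    ultimately show "C \<in> ?J - {{}}" using x by (auto simp: join_part_def)
  qed
  have inj: "inj_on ?F (itin T X n ` space M)"
    by (rule inj_onI) auto
  have fin: "finite (itin T X n ` space M)"
    using simple_function_itin[OF X] by (rule simple_functionD)
  then have "finite (?J - {{}})" unfolding J by (rule finite_imageI)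
  then have finJ: "finite ?J" by simp
  have "(\<Sum>A\<in>?J. measure M A * ln (measure M A)) = (\<Sum>A\<in>?J - {{}}. measure M A * ln (measure M A))"
    using finJ by (intro sum.mono_neutral_right) auto
  also have "\<dots> = (\<Sum>w\<in>itin T X n ` space M. fib M (itin T X n) w * ln (fib M (itin T X n) w))"
    unfolding J by (subst sum.reindex[OF inj]) (simp add: fib_def)
  finally show ?thesis
    by (simp add: part_entropy_def ent_eq_sum[OF simple_function_itin[OF X]])
qed

end

section \<open>An ergodic theorem for almost additive sequences\<close>

text \<open>The upper limit is taken in the extended reals, in line with
  \<open>pressure_eps\<close>; the conversion back is faithful for sequences of at most linear
  growth.\<close>

definition limavg :: "(nat \<Rightarrow> real) \<Rightarrow> real" where
  "limavg u = real_of_ereal (limsup (\<lambda>n. ereal (u n / real n)))"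

lemma avg_bound:
  assumes "\<And>n. \<bar>u n\<bar> \<le> K * real n" and "0 \<le> K"
  shows "\<bar>u n / real n\<bar> \<le> (K::real)"
  using assms(1)[of n] assms(2) by (cases "n = 0") (auto simp: field_simps)

lemma limavg_finite:
  assumes u: "\<And>n. \<bar>u n\<bar> \<le> K * real n" and K: "0 \<le> K"
  shows "ereal (limavg u) = limsup (\<lambda>n. ereal (u n / real n))" and "\<bar>limavg u\<bar> \<le> K"
proof -
  let ?L = "limsup (\<lambda>n. ereal (u n / real n))"
  have b: "- K \<le> u n / real n" "u n / real n \<le> K" for n
    using avg_bound[of u K n, OF u K] by linarith+
  have "?L \<le> ereal K" using b by (intro Limsup_bounded) auto
  moreover have "ereal (- K) \<le> liminf (\<lambda>n. ereal (u n / real n))"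
    using b by (intro Liminf_bounded) auto
  then have "ereal (- K) \<le> ?L"
    using Liminf_le_Limsup[of sequentially "\<lambda>n. ereal (u n / real n)"] by (simp add: order_trans)
  ultimately show "ereal (limavg u) = ?L" and "\<bar>limavg u\<bar> \<le> K"
    unfolding limavg_def by (cases ?L; auto)+
qed

lemma limavg_frequently:
  assumes u: "\<And>n. \<bar>u n\<bar> \<le> K * real n" and K: "0 \<le> K" and c: "c < limavg u"
  shows "\<exists>\<^sub>F n in sequentially. c < u n / real n"
proof (rule ccontr)
  assume "\<not> ?thesis"
  then have "\<forall>\<^sub>F n in sequentially. ereal (u n / real n) \<le> ereal c"
    by (auto simp: frequently_def not_less elim: eventually_mono)
  then have "limsup (\<lambda>n. ereal (u n / real n)) \<le> ereal c" by (rule Limsup_bounded)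
  then show False using c limavg_finite(1)[of u K, OF u K] by (metis ereal_less_eq(3) not_less)
qed

lemma limavg_asymp:
  assumes "(\<lambda>n. u n / real n - v n / real n) \<longlonglongrightarrow> c"
  shows "limsup (\<lambda>n. ereal (u n / real n)) = ereal c + limsup (\<lambda>n. ereal (v n / real n))"
proof -
  have "limsup (\<lambda>n. ereal (u n / real n - v n / real n) + ereal (v n / real n))
      = ereal c + limsup (\<lambda>n. ereal (v n / real n))"
    by (rule ereal_limsup_lim_add) (use assms in auto)
  then show ?thesis by simp
qed

lemma limavg_uminus:
  assumes u: "\<And>n. \<bar>u n\<bar> \<le> K * real n" and K: "0 \<le> K"
  shows "- limavg u \<le> limavg (\<lambda>n. - u n)"
proof -
  have "ereal (limavg (\<lambda>n. - u n)) = limsup (\<lambda>n. - ereal (u n / real n))"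
    using limavg_finite(1)[of "\<lambda>n. - u n" K] u K by simp
  also have "\<dots> = - liminf (\<lambda>n. ereal (u n / real n))" by (rule ereal_Limsup_uminus)
  also have "\<dots> \<ge> - limsup (\<lambda>n. ereal (u n / real n))"
    using Liminf_le_Limsup[of sequentially "\<lambda>n. ereal (u n / real n)"] by simp
  finally show ?thesis using limavg_finite(1)[of u K, OF u K] by (metis ereal_less_eq(3) uminus_ereal.simps(1))
qed

text \<open>With \<open>u\<close> read along the orbit of \<open>x\<close> and \<open>v\<close>
  along that of \<open>T x\<close>, this makes upper averages invariant: moving the index changes
  the quotient by at most \<open>(D + K) / Suc n\<close>.\<close>

lemma limavg_shift:
  assumes d: "\<And>n. \<bar>u (Suc n) - v n\<bar> \<le> D"
    and v: "\<And>n. \<bar>v n\<bar> \<le> K * real n"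
  shows "limavg u = limavg v"
proof -
  have "(\<lambda>n. u (Suc n) / real (Suc n) - v n / real n) \<longlonglongrightarrow> 0"
  proof (rule Lim_null_comparison)
    show "\<forall>\<^sub>F n in sequentially. norm (u (Suc n) / real (Suc n) - v n / real n) \<le> (D + K) / real (Suc n)"
    proof (rule eventually_sequentiallyI[of 1])
      fix n :: nat assume n: "1 \<le> n"
      have "u (Suc n) / real (Suc n) - v n / real n
          = (u (Suc n) - v n) / real (Suc n) - (v n / real n) / real (Suc n)"
        using n by (simp add: diff_divide_distrib) (simp add: divide_simps; simp add: algebra_simps)
      also have "\<bar>\<dots>\<bar> \<le> \<bar>u (Suc n) - v n\<bar> / real (Suc n) + \<bar>v n / real n\<bar> / real (Suc n)"
        by (metis (no_types, opaque_lifting) abs_divide abs_of_nat abs_triangle_ineq4)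
      also have "\<dots> \<le> D / real (Suc n) + K / real (Suc n)"
        using d[of n] v[of n] n by (intro add_mono divide_right_mono) (auto simp: field_simps)
      finally show "norm (u (Suc n) / real (Suc n) - v n / real n) \<le> (D + K) / real (Suc n)"
        by (simp add: add_divide_distrib)
    qed
    show "(\<lambda>n. (D + K) / real (Suc n)) \<longlonglongrightarrow> 0"
      using lim_const_over_n[of "D + K"] by (rule LIMSEQ_Suc)
  qed
  then have "(\<lambda>n. ereal (u (Suc n) / real (Suc n) - v n / real n)) \<longlonglongrightarrow> ereal 0" by simp
  then have "limsup (\<lambda>n. ereal (u (Suc n) / real (Suc n) - v n / real n) + ereal (v n / real n))
      = ereal 0 + limsup (\<lambda>n. ereal (v n / real n))"
    by (rule ereal_limsup_lim_add) auto
  then have "limsup (\<lambda>n. ereal (u (Suc n) / real (Suc n))) = limsup (\<lambda>n. ereal (v n / real n))" by simp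
  then show ?thesis
    unfolding limavg_def using limsup_shift[of "\<lambda>n. ereal (u n / real n)"] by simp
qed

section \<open>Maximal inequality and the integrated ergodic theorem\<close>

context mpt
begin

text \<open>Garsia's argument. The running maximum \<open>m n\<close> is nonnegative because time 0
  contributes 0. Where it is positive it is attained at some time \<open>Suc i\<close>, so
  \<open>m n x \<le> s 1 x + m n (T x)\<close>; elsewhere \<open>m n x - m n (T x) \<le> 0\<close>.
  This difference integrates to 0 by invariance, so \<open>s 1\<close> has nonnegative integral over
  the set where \<open>m n\<close> is positive, and by \<open>pos\<close> these sets exhaust the
  space.\<close>

lemma maximal_ineq:
  fixes s :: "nat \<Rightarrow> 'a \<Rightarrow> real"
  assumes int: "\<And>n. integrable M (s n)" and s0: "\<And>x. s 0 x = 0"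
    and sub: "\<And>n x. x \<in> space M \<Longrightarrow> s (Suc n) x \<le> s 1 x + s n (T x)"
    and pos: "\<And>x. x \<in> space M \<Longrightarrow> \<exists>n. 0 < s n x"
  shows "0 \<le> (\<integral>x. s 1 x \<partial>M)"
proof -
  define m where "m n x = rec_nat 0 (\<lambda>i r. max r (s (Suc i) x)) n" for n x
  have m_simps: "m 0 x = 0" "m (Suc n) x = max (m n x) (s (Suc n) x)" for n x
    by (simp_all add: m_def)
  have m_int: "integrable M (m n)" for n
  proof (induction n)
    case 0
    then show ?case by (simp add: m_simps(1)[abs_def])
  next
    case (Suc n)
    then show ?case unfolding m_simps(2)[abs_def] using int by (intro integrable_max) auto
  qed
  have m_ge: "j \<le> n \<Longrightarrow> s j x \<le> m n x" for j n x
    by (induction n) (auto simp: m_simps s0 le_Suc_eq)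
  have m_nonneg: "0 \<le> m n x" for n x using m_ge[of 0 n x] s0 by simp
  have m_attained: "\<exists>j\<le>n. m n x = s j x" for n x
  proof (induction n)
    case (Suc n)
    then obtain j where "j \<le> n" "m n x = s j x" by blast
    then show ?case unfolding m_simps max_def by (metis le_Suc_eq order_refl)
  qed (auto simp: m_simps s0)
  have key: "m n x - m n (T x) \<le> indicator {x \<in> space M. 0 < m n x} x * s 1 x" if x: "x \<in> space M" for n x
  proof (cases "0 < m n x")
    case True
    obtain j where j: "j \<le> n" "m n x = s j x" using m_attained by blast
    with True s0 obtain i where i: "j = Suc i" by (cases j) auto
    have "s j x \<le> s 1 x + m n (T x)"
      using sub[OF x, of i] m_ge[of i n "T x"] j(1) i by simp
    then show ?thesis using True x j by simp
  next
    case False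
    then show ?thesis using m_nonneg[of n "T x"] m_nonneg[of n x] x by simp
  qed
  have set: "{x \<in> space M. 0 < m n x} \<in> sets M" for n
    using borel_measurable_integrable[OF m_int[of n]] by measurable
  have step: "0 \<le> (\<integral>x. indicator {x \<in> space M. 0 < m n x} x * s 1 x \<partial>M)" for n
  proof -
    have mT: "integrable M (\<lambda>x. m n (T x))" 
      using integrable_distr[of T M M "m n"] T m_int[of n] distr_T by simp
    have "0 = (\<integral>x. m n x \<partial>M) - (\<integral>x. m n (T x) \<partial>M)"
      using integral_funpow[OF borel_measurable_integrable[OF m_int[of n]], of 1] by simp
    also have "\<dots> = (\<integral>x. m n x - m n (T x) \<partial>M)"
      using m_int mT by (simp add: Bochner_Integration.integral_diff)
    also have "\<dots> \<le> (\<integral>x. indicator {x \<in> space M. 0 < m n x} x * s 1 x \<partial>M)"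
    proof (rule integral_mono)
      show "integrable M (\<lambda>x. m n x - m n (T x))" using m_int mT by auto
      show "integrable M (\<lambda>x. indicator {x \<in> space M. 0 < m n x} x * s 1 x)"
        using integrable_mult_indicator[OF set int[of 1]] by simp
    qed (rule key)
    finally show ?thesis .
  qed
  have "(\<lambda>n. \<integral>x. indicator {x \<in> space M. 0 < m n x} x * s 1 x \<partial>M) \<longlonglongrightarrow> (\<integral>x. s 1 x \<partial>M)"
  proof (rule integral_dominated_convergence[where w = "\<lambda>x. \<bar>s 1 x\<bar>"])
    show "AE x in M. (\<lambda>n. indicator {x \<in> space M. 0 < m n x} x * s 1 x) \<longlonglongrightarrow> s 1 x"
    proof (rule AE_I2)
      fix x assume x: "x \<in> space M"
      then obtain N where N: "0 < s N x" using pos by blast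
      have "\<forall>\<^sub>F n in sequentially. indicator {x \<in> space M. 0 < m n x} x * s 1 x = s 1 x"
        by (rule eventually_sequentiallyI[of N])
          (use x N m_ge order_less_le_trans in \<open>fastforce\<close>)
      then show "(\<lambda>n. indicator {x \<in> space M. 0 < m n x} x * s 1 x) \<longlonglongrightarrow> s 1 x"
        by (rule tendsto_eventually)
    qed
    show "AE x in M. norm (indicator {x \<in> space M. 0 < m n x} x * s 1 x) \<le> \<bar>s 1 x\<bar>" for n
      by (auto simp: indicator_def)
    show "(\<lambda>x. indicator {x \<in> space M. 0 < m n x} x * s 1 x) \<in> borel_measurable M" for n
      using set[of n] borel_measurable_integrable[OF int[of 1]] by measurable
  qed (use int in auto)
  then show ?thesis by (rule LIMSEQ_le_const) (use step in auto)
qed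

end

text \<open>Used with logarithms of cylinder masses, where \<open>C\<close> comes from the
  quasi-Bernoulli property, and with visit counts, where \<open>C = 0\<close> and
  \<open>K = 1\<close>.\<close>

locale almost_additive_cocycle = mpt +
  fixes a :: "nat \<Rightarrow> 'a \<Rightarrow> real" and C K :: real
  assumes meas: "a n \<in> borel_measurable M"
    and add: "x \<in> space M \<Longrightarrow> \<bar>a (n + m) x - a n x - a m ((T ^^ n) x)\<bar> \<le> C"
    and bd: "x \<in> space M \<Longrightarrow> \<bar>a n x\<bar> \<le> K * real n"
begin

lemma K_nonneg: "0 \<le> K"
proof -
  obtain x where "x \<in> space M" using not_empty by blast
  from bd[OF this, of 1] show ?thesis by simp
qed

lemma C_nonneg: "0 \<le> C"
proof -
  obtain x where "x \<in> space M" using not_empty by blast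
  from add[OF this, of 0 0] show ?thesis by simp
qed

definition ulim :: "'a \<Rightarrow> real" where "ulim x = limavg (\<lambda>n. a n x)"

lemma ulim_measurable: "ulim \<in> borel_measurable M"
  unfolding ulim_def limavg_def using meas by measurable

lemma ulim_bound: "x \<in> space M \<Longrightarrow> \<bar>ulim x\<bar> \<le> K"
  unfolding ulim_def using bd K_nonneg by (intro limavg_finite) auto

lemma ulim_T: "x \<in> space M \<Longrightarrow> ulim (T x) = ulim x"
  unfolding ulim_def
proof (rule limavg_shift[symmetric])
  fix n assume x: "x \<in> space M"
  show "\<bar>a (Suc n) x - a n (T x)\<bar> \<le> C + K"
    using add[OF x, of 1 n] bd[OF x, of 1] by simp
  show "\<bar>a n (T x)\<bar> \<le> K * real n" using bd funpow_space[OF x, of 1] by simp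
qed

lemma ulim_funpow: "x \<in> space M \<Longrightarrow> ulim ((T ^^ n) x) = ulim x"
  by (induction n) (auto simp: ulim_T funpow_space)

lemma integrable_bounded:
  fixes g :: "'a \<Rightarrow> real"
  assumes "g \<in> borel_measurable M" "\<And>x. x \<in> space M \<Longrightarrow> \<bar>g x\<bar> \<le> B"
  shows "integrable M g"
  using assms by (intro integrable_const_bound[of _ B]) auto

lemma integrable_a: "integrable M (a n)"
  using bd meas by (intro integrable_bounded[of _ "K * real n"]) auto

lemma integrable_ulim: "integrable M ulim"
  using ulim_bound ulim_measurable by (intro integrable_bounded[of _ K]) auto

text \<open>Garsia's maximal inequality is applied to \<open>T ^^ N\<close> rather than to \<open>T\<close>, so that the defect \<open>C\<close> of
  additivity is paid only once in \<open>N\<close> steps.\<close>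

lemma ulim_upper:
  assumes N: "1 \<le> N"
  shows "real N * (\<integral>x. ulim x \<partial>M) \<le> (\<integral>x. a N x \<partial>M) + C"
proof (rule field_le_epsilon)
  fix e' :: real assume e': "0 < e'"
  define e where "e = e' / real N"
  have e: "0 < e" using e' N by (simp add: e_def)
  \<comment> \<open>Adding \<open>C\<close> makes \<open>s\<close> subadditive along
    \<open>T ^^ N\<close>: the defect of each concatenation is paid by the \<open>C\<close> of one
    summand. Lowering the upper average by \<open>e\<close> makes some \<open>s j x\<close>
    positive.\<close>
  define s where "s j x = (if j = 0 then 0 else a (j * N) x + C - real (j * N) * (ulim x - e))" for j x
  have "0 \<le> (\<integral>x. s 1 x \<partial>M)"
  proof (rule mpt.maximal_ineq[OF mpt_funpow[of N]])
    show "integrable M (s n)" for n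
      using integrable_a integrable_ulim by (cases "n = 0") (auto simp: s_def[abs_def])
    show "s 0 x = 0" for x by (simp add: s_def)
    show "s (Suc n) x \<le> s 1 x + s n ((T ^^ N) x)" if x: "x \<in> space M" for n x
    proof (cases "n = 0")
      case False
      then show ?thesis using add[OF x, of N "n * N"]
        by (simp add: s_def ulim_funpow[OF x] algebra_simps)
    qed (simp add: s_def)
    show "\<exists>j. 0 < s j x" if x: "x \<in> space M" for x
    proof -
      \<comment> \<open>A time \<open>n\<close> with average above \<open>ulim x - e / 2\<close> is
        rounded down to \<open>j * N\<close>. This costs at most \<open>N * K\<close> in
        \<open>a\<close>, \<open>N * K\<close> in the upper average and \<open>N * e\<close>; beyond
        \<open>n0\<close> the gain \<open>n * e / 2\<close> outweighs them.\<close>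
      obtain n0 :: nat where n0: "real n0 > 2 * (2 * real N * K + real N * e) / e"
        using reals_Archimedean2 by blast
      have "\<exists>\<^sub>F n in sequentially. ulim x - e / 2 < a n x / real n"
        using limavg_frequently[of "\<lambda>n. a n x" K "ulim x - e / 2"] bd[OF x] K_nonneg e
        by (simp add: ulim_def)
      then obtain n where n: "n \<ge> max N n0" "ulim x - e / 2 < a n x / real n"
        unfolding frequently_sequentially by blast
      define j where "j = n div N"
      define r where "r = n mod N"
      have jr: "n = j * N + r" by (simp add: j_def r_def)
      have r: "r < N" using N by (simp add: r_def)
      have j: "j \<noteq> 0" using n(1) N by (simp add: j_def div_eq_0_iff)
      have nN: "real (j * N) = real n - real r" using jr by simp
      have rK: "real r * K \<le> real N * K" using r K_nonneg by (intro mult_right_mono) auto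
      have "a n x \<le> a (j * N) x + a r ((T ^^ (j * N)) x) + C"
        using add[OF x, of "j * N" r] jr by simp
      moreover have "a r ((T ^^ (j * N)) x) \<le> real N * K"
        using bd[OF funpow_space[OF x], of r "j * N"] rK by (simp add: mult.commute)
      moreover have "real n * (ulim x - e / 2) < a n x"
        using n N by (simp add: field_simps)
      ultimately have "s j x > real n * (ulim x - e / 2) - real N * K - (real n - real r) * (ulim x - e)"
        using j nN by (simp add: s_def)
      moreover have "real n * (ulim x - e / 2) - real N * K - (real n - real r) * (ulim x - e)
          = real n * e / 2 - real N * K + real r * ulim x - real r * e" by (simp add: algebra_simps)
      moreover have "real r * ulim x \<ge> - (real N * K)"
      proof -
        have "real r * - K \<le> real r * ulim x" using ulim_bound[OF x] by (intro mult_left_mono) auto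
        then show ?thesis using rK by simp
      qed
      moreover have "real r * e \<le> real N * e" using r e by simp
      moreover have "2 * (2 * real N * K + real N * e) < real n * e"
      proof -
        have "2 * (2 * real N * K + real N * e) / e < real n" using n0 n(1) by simp
        then show ?thesis using e by (simp only: pos_divide_less_eq)
      qed
      ultimately have "0 < s j x" by argo
      then show ?thesis by blast
    qed
  qed
  also have "(\<integral>x. s 1 x \<partial>M) = (\<integral>x. a N x \<partial>M) + C - real N * (\<integral>x. ulim x \<partial>M) + real N * e"
    using integrable_a integrable_ulim
    by (simp add: s_def prob_space algebra_simps)
  finally show "real N * (\<integral>x. ulim x \<partial>M) \<le> (\<integral>x. a N x \<partial>M) + C + e'"
    using N by (simp add: e_def)
qed

text \<open>The upper bounds for \<open>a\<close> and for \<open>- a\<close> pinch the integral,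
  since the upper average of \<open>- a\<close> is at least minus that of \<open>a\<close>. The
  averaged integrals are within \<open>C / n\<close> of the limit; nothing is claimed about
  pointwise convergence.\<close>

lemma integral_ulim: "(\<lambda>n. (\<integral>x. a n x \<partial>M) / real n) \<longlonglongrightarrow> (\<integral>x. ulim x \<partial>M)"
proof -
  interpret neg: almost_additive_cocycle M T "\<lambda>n x. - a n x" C K
  proof unfold_locales
    show "(\<lambda>x. - a n x) \<in> borel_measurable M" for n using meas by simp
  next
    fix x n m assume x: "x \<in> space M"
    show "\<bar>- a (n + m) x - - a n x - - a m ((T ^^ n) x)\<bar> \<le> C" using add[OF x, of n m] by linarith
  qed (use bd in simp)
  have ge: "- (\<integral>x. ulim x \<partial>M) \<le> (\<integral>x. neg.ulim x \<partial>M)"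
  proof -
    have "(\<integral>x. - ulim x \<partial>M) \<le> (\<integral>x. neg.ulim x \<partial>M)"
    proof (rule integral_mono)
      show "- ulim x \<le> neg.ulim x" if "x \<in> space M" for x
        unfolding ulim_def neg.ulim_def by (rule limavg_uminus[OF bd[OF that] K_nonneg])
    qed (use integrable_ulim neg.integrable_ulim in auto)
    then show ?thesis by simp
  qed
  show ?thesis
  proof (rule LIM_zero_cancel, rule Lim_null_comparison)
    show "\<forall>\<^sub>F n in sequentially. norm ((\<integral>x. a n x \<partial>M) / real n - (\<integral>x. ulim x \<partial>M)) \<le> C / real n"
    proof (rule eventually_sequentiallyI[of 1])
      fix n :: nat assume n: "1 \<le> n"
      have "real n * - (\<integral>x. ulim x \<partial>M) \<le> real n * (\<integral>x. neg.ulim x \<partial>M)"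
        using ge by (rule mult_left_mono) simp
      then have "\<bar>(\<integral>x. a n x \<partial>M) - real n * (\<integral>x. ulim x \<partial>M)\<bar> \<le> C"
        using ulim_upper[OF n] neg.ulim_upper[OF n] by simp
      moreover have "(\<integral>x. a n x \<partial>M) / real n - (\<integral>x. ulim x \<partial>M)
          = ((\<integral>x. a n x \<partial>M) - real n * (\<integral>x. ulim x \<partial>M)) / real n"
        using n by (simp add: field_simps)
      ultimately show "norm ((\<integral>x. a n x \<partial>M) / real n - (\<integral>x. ulim x \<partial>M)) \<le> C / real n"
        by (simp add: divide_right_mono)
    qed
    show "(\<lambda>n. C / real n) \<longlonglongrightarrow> 0" by (rule lim_const_over_n)
  qed
qed

end

section \<open>Invariant measures on the full shift and the generator theorem\<close>

text \<open>Prefixes are encoded as itineraries of the zeroth coordinate, so that the results on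
  itineraries apply to words.\<close>

abbreviation pre :: "nat \<Rightarrow> (nat \<Rightarrow> nat) \<Rightarrow> nat list" where
  "pre \<equiv> itin shift (\<lambda>x. x 0)"

lemma shift_funpow: "(shift ^^ n) x = (\<lambda>i. x (n + i))"
  by (induction n arbitrary: x) (simp_all add: shift_def funpow_swap1)

lemma pre_eq: "pre n x = map x [0..<n]"
  by (simp add: itin_def shift_funpow)

lemma pre_eq_iff: "pre n x = w \<longleftrightarrow> length w = n \<and> (\<forall>i<n. x i = w ! i)"
proof
  assume "pre n x = w"
  then show "length w = n \<and> (\<forall>i<n. x i = w ! i)" by (auto simp: nth_itin shift_funpow)
next
  assume "length w = n \<and> (\<forall>i<n. x i = w ! i)"
  then show "pre n x = w" by (intro nth_equalityI) (auto simp: nth_itin shift_funpow)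
qed

lemma shift_fullshift: "x \<in> fullshift k \<Longrightarrow> shift x \<in> fullshift k"
  by (simp add: fullshift_def shift_def)

lemma space_shift_space [simp]: "space (shift_space k) = fullshift k"
  by (simp add: shift_space_def space_restrict_space)

section \<open>Approximation of Borel sets by cylinder sets\<close>

text \<open>Any set of words is allowed, including words of another length or alphabet. Complements
  are then given by \<open>- U\<close>, and different lengths are aligned by
  \<open>take\<close>.\<close>

definition cset :: "nat \<Rightarrow> nat \<Rightarrow> nat list set \<Rightarrow> (nat \<Rightarrow> nat) set" where
  "cset k m U = {x \<in> fullshift k. pre m x \<in> U}"

lemma cset_measurable: "cset k m U \<in> sets (shift_space k)"
proof -
  have c: "(\<lambda>x::nat \<Rightarrow> nat. x i) -` A \<in> sets borel" for i :: nat and A :: "nat set"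
  proof (rule borel_open)
    have "open A" by (rule discrete_topology_class.open_discrete)
    then show "open ((\<lambda>x::nat \<Rightarrow> nat. x i) -` A)"
      by (rule open_vimage) (rule continuous_on_product_coordinates)
  qed
  have "pre m -` {w} \<in> sets borel" for w
  proof -
    have eq: "pre m -` {w} = (if length w = m then \<Inter>i\<in>{..<m}. (\<lambda>x. x i) -` {w ! i} else {})"
      by (auto simp: pre_eq_iff)
    have "(\<Inter>i\<in>{..<m}. (\<lambda>x::nat \<Rightarrow> nat. x i) -` {w ! i}) \<in> sets borel"
    proof (cases "m = 0")
      case False
      then show ?thesis by (intro sets.finite_INT c) auto
    qed simp
    then show ?thesis unfolding eq by simp
  qed
  then have "(\<Union>w\<in>U. pre m -` {w}) \<in> sets borel"
    by (intro sets.countable_UN') (auto intro: countableI_type)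
  moreover have "cset k m U = fullshift k \<inter> (\<Union>w\<in>U. pre m -` {w})" by (auto simp: cset_def)
  ultimately show ?thesis by (auto simp: shift_space_def sets_restrict_space)
qed

lemma shift_measurable: "shift \<in> shift_space k \<rightarrow>\<^sub>M shift_space k"
proof -
  have "continuous_on UNIV shift"
    unfolding shift_def
    by (intro continuous_on_coordinatewise_then_product continuous_on_product_coordinates)
  then have "shift \<in> borel_measurable borel" by (rule borel_measurable_continuous_onI)
  then show ?thesis
    unfolding shift_space_def using shift_fullshift by (intro measurable_restrict_space3) auto
qed

lemma cset_Compl: "fullshift k - cset k m U = cset k m (- U)"
  by (auto simp: cset_def)

lemma cset_mono_length: "m \<le> n \<Longrightarrow> cset k m U = cset k n {w. take m w \<in> U}"
  by (auto simp: cset_def pre_eq take_map take_upt)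

lemma cset_Un: "\<exists>l W. cset k m U \<union> cset k n V = cset k l W"
proof -
  have "cset k m U \<union> cset k n V
      = cset k (max m n) {w. take m w \<in> U} \<union> cset k (max m n) {w. take n w \<in> V}"
    using cset_mono_length[of m "max m n"] cset_mono_length[of n "max m n"] by simp
  also have "\<dots> = cset k (max m n) ({w. take m w \<in> U} \<union> {w. take n w \<in> V})"
    by (auto simp: cset_def)
  finally show ?thesis by blast
qed

text \<open>Two measures are later compared on one cylinder set that approximates \<open>A\<close>
  for both, hence the finite family. Sets with such approximations form a sigma-algebra: a
  complement replaces \<open>U\<close> by \<open>- U\<close>, and a countable union is first cut to
  a finite one that is good for every member of the family.\<close>

lemma cset_approx:
  assumes fin: "finite \<M>" and fm: "\<And>M. M \<in> \<M> \<Longrightarrow> finite_measure M"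
    and sets: "\<And>M. M \<in> \<M> \<Longrightarrow> sets M = sets (shift_space k)"
    and A: "A \<in> sets (shift_space k)" and e: "0 < e"
  shows "\<exists>m U. \<forall>M\<in>\<M>. measure M (sym_diff A (cset k m U)) < e"
proof -
  define appr where "appr A \<longleftrightarrow> A \<in> sets (shift_space k) \<and>
    (\<forall>e>0. \<exists>m U. \<forall>M\<in>\<M>. measure M (sym_diff A (cset k m U)) < e)" for A
  have mono: "measure M A \<le> measure M B"
    if "M \<in> \<M>" "A \<subseteq> B" "B \<in> sets (shift_space k)" for M A B
    using finite_measure.finite_measure_mono[OF fm[OF that(1)] that(2)] that sets by simp
  have sub: "measure M (A \<union> B) \<le> measure M A + measure M B"
    if "M \<in> \<M>" "A \<in> sets (shift_space k)" "B \<in> sets (shift_space k)" for M A B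
    using measure_Un_le[of A M B] that sets by simp
  have Un: "appr (A \<union> B)" if A: "appr A" and B: "appr B" for A B
    unfolding appr_def
  proof (intro conjI allI impI)
    show AB: "A \<union> B \<in> sets (shift_space k)" using A B by (auto simp: appr_def)
    fix e :: real assume "0 < e"
    then obtain m U n V where U: "\<forall>M\<in>\<M>. measure M (sym_diff A (cset k m U)) < e / 2"
      and V: "\<forall>M\<in>\<M>. measure M (sym_diff B (cset k n V)) < e / 2"
      using A B unfolding appr_def by (meson half_gt_zero)
    obtain l W where W: "cset k m U \<union> cset k n V = cset k l W" using cset_Un by blast
    have "measure M (sym_diff (A \<union> B) (cset k l W)) < e" if M: "M \<in> \<M>" for M
    proof -
      have m: "sym_diff A (cset k m U) \<in> sets (shift_space k)" "sym_diff B (cset k n V) \<in> sets (shift_space k)"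
        using A B cset_measurable by (auto simp: appr_def)
      have "measure M (sym_diff (A \<union> B) (cset k l W))
          \<le> measure M (sym_diff A (cset k m U) \<union> sym_diff B (cset k n V))"
        using m by (intro mono[OF M]) (auto simp: W[symmetric])
      also have "\<dots> \<le> measure M (sym_diff A (cset k m U)) + measure M (sym_diff B (cset k n V))"
        by (rule sub[OF M m])
      also have "\<dots> < e" using U V M by (metis add_strict_mono field_sum_of_halves)
      finally show ?thesis .
    qed
    then show "\<exists>m U. \<forall>M\<in>\<M>. measure M (sym_diff (A \<union> B) (cset k m U)) < e" by blast
  qed
  have cset: "appr (cset k m U)" for m U
    unfolding appr_def using cset_measurable by (intro conjI allI impI exI[of _ m] exI[of _ U]) auto
  have "appr (fullshift k \<inter> B)" if "B \<in> sets borel" for B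
  proof -
    \<comment> \<open>The Borel sets of the product are generated by conditions on a single
      coordinate, and these are cylinder sets.\<close>
    have "B \<in> sigma_sets (\<Pi>\<^sub>E i\<in>UNIV. UNIV) {{f \<in> \<Pi>\<^sub>E i\<in>UNIV. UNIV. f i \<in> A} |i A. i \<in> UNIV \<and> A \<in> sets borel}"
      using that unfolding sets_PiM_equal_borel[symmetric] sets_PiM_single by simp
    then show ?thesis
    proof (induction rule: sigma_sets.induct)
      case (Basic B)
      then obtain i A where "B = {f. f i \<in> A}" by auto
      then have "fullshift k \<inter> B = cset k (Suc i) {w. w ! i \<in> A}"
        by (auto simp: cset_def pre_eq simp del: upt_Suc)
      then show ?case using cset by simp
    next
      case Empty
      have "fullshift k \<inter> {} = cset k 0 {}" by (auto simp: cset_def)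
      then show ?case using cset by metis
    next
      case (Compl B)
      have eq: "fullshift k \<inter> ((\<Pi>\<^sub>E i\<in>UNIV. UNIV) - B) = fullshift k - fullshift k \<inter> B" by auto
      have "sym_diff (fullshift k - fullshift k \<inter> B) (cset k m (- U)) = sym_diff (fullshift k \<inter> B) (cset k m U)" for m U
        by (auto simp: cset_def)
      note sd = this
      have "\<exists>m U. \<forall>M\<in>\<M>. measure M (sym_diff (fullshift k - fullshift k \<inter> B) (cset k m U)) < e"
        if e: "0 < e" for e :: real
      proof -
        obtain m U where "\<forall>M\<in>\<M>. measure M (sym_diff (fullshift k \<inter> B) (cset k m U)) < e"
          using Compl.IH e unfolding appr_def by blast
        then show ?thesis by (intro exI[of _ m] exI[of _ "- U"]) (simp only: sd)
      qed
      moreover have "fullshift k - fullshift k \<inter> B \<in> sets (shift_space k)"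
        using Compl.IH sets.compl_sets[of "fullshift k \<inter> B" "shift_space k"] by (simp add: appr_def)
      ultimately show ?case unfolding eq appr_def by blast
    next
      case (Union a)
      let ?a = "\<lambda>i. fullshift k \<inter> a i"
      have am: "?a i \<in> sets (shift_space k)" for i using Union by (simp add: appr_def)
      have fu: "appr (\<Union>i<n. ?a i)" for n
      proof (induction n)
        case 0
        have "(\<Union>i<0. ?a i) = cset k 0 {}" by (auto simp: cset_def)
        then show ?case using cset by metis
      next
        case (Suc n)
        have "(\<Union>i<Suc n. ?a i) = (\<Union>i<n. ?a i) \<union> ?a n" by (auto simp: less_Suc_eq)
        then show ?case using Un[OF Suc Union.IH[of n]] by (simp only:)
      qed
      have eq: "fullshift k \<inter> \<Union> (range a) = (\<Union>i. ?a i)" by auto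
      have um: "(\<Union>i. ?a i) \<in> sets (shift_space k)" by (rule sets.countable_UN) (use am in auto)
      have fum: "(\<Union>i<n. ?a i) \<in> sets (shift_space k)" for n using fu by (simp add: appr_def)
      show ?case unfolding eq appr_def
      proof (intro conjI allI impI um)
        fix e :: real assume e: "0 < e"
        have "\<forall>\<^sub>F n in sequentially. measure M ((\<Union>i. ?a i) - (\<Union>i<n. ?a i)) < e / 2" if M: "M \<in> \<M>" for M
        proof (rule order_tendstoD)
          have inc: "incseq (\<lambda>n. \<Union>i<n. ?a i)"
            by (rule incseq_SucI, rule UN_mono) auto
          have "(\<lambda>n. measure M (\<Union>i<n. ?a i)) \<longlonglongrightarrow> measure M (\<Union>n. \<Union>i<n. ?a i)"
            by (rule finite_measure.finite_Lim_measure_incseq[OF fm[OF M]])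
              (use fum sets[OF M] inc in auto)
          also have "(\<Union>n. \<Union>i<n. ?a i) = (\<Union>i. ?a i)" by auto
          finally have "(\<lambda>n. measure M (\<Union>i. ?a i) - measure M (\<Union>i<n. ?a i))
              \<longlonglongrightarrow> measure M (\<Union>i. ?a i) - measure M (\<Union>i. ?a i)"
            by (intro tendsto_diff tendsto_const)
          moreover have "measure M ((\<Union>i. ?a i) - (\<Union>i<n. ?a i)) = measure M (\<Union>i. ?a i) - measure M (\<Union>i<n. ?a i)" for n
            using um fum sets[OF M] by (intro finite_measure.finite_measure_Diff[OF fm[OF M]]) auto
          ultimately show "(\<lambda>n. measure M ((\<Union>i. ?a i) - (\<Union>i<n. ?a i))) \<longlonglongrightarrow> 0" by simp
        qed (use e in simp)
        then have "\<forall>\<^sub>F n in sequentially. \<forall>M\<in>\<M>. measure M ((\<Union>i. ?a i) - (\<Union>i<n. ?a i)) < e / 2"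
          using fin by (simp add: eventually_ball_finite)
        then obtain n where n: "\<forall>M\<in>\<M>. measure M ((\<Union>i. ?a i) - (\<Union>i<n. ?a i)) < e / 2"
          by (auto simp: eventually_sequentially)
        obtain m U where U: "\<forall>M\<in>\<M>. measure M (sym_diff (\<Union>i<n. ?a i) (cset k m U)) < e / 2"
          using fu[of n] e unfolding appr_def by (meson half_gt_zero)
        have "measure M (sym_diff (\<Union>i. ?a i) (cset k m U)) < e" if M: "M \<in> \<M>" for M
        proof -
          have m: "(\<Union>i. ?a i) - (\<Union>i<n. ?a i) \<in> sets (shift_space k)"
            "sym_diff (\<Union>i<n. ?a i) (cset k m U) \<in> sets (shift_space k)"
            using um fum cset_measurable by auto
          have "measure M (sym_diff (\<Union>i. ?a i) (cset k m U))
            \<le> measure M (((\<Union>i. ?a i) - (\<Union>i<n. ?a i)) \<union> sym_diff (\<Union>i<n. ?a i) (cset k m U))"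
            by (rule mono[OF M]) (use m in \<open>(blast | simp)+\<close>)
          also have "\<dots> \<le> measure M ((\<Union>i. ?a i) - (\<Union>i<n. ?a i)) + measure M (sym_diff (\<Union>i<n. ?a i) (cset k m U))"
            by (rule sub[OF M m])
          also have "\<dots> < e" using U n M by (metis add_strict_mono field_sum_of_halves)
          finally show ?thesis .
        qed
        then show "\<exists>m U. \<forall>M\<in>\<M>. measure M (sym_diff (\<Union>i. ?a i) (cset k m U)) < e" by blast
      qed
    qed
  qed
  moreover obtain B where "B \<in> sets borel" "A = fullshift k \<inter> B"
    using A by (auto simp: shift_space_def sets_restrict_space)
  ultimately have "appr A" by simp
  then show ?thesis using e by (simp add: appr_def)
qed

locale shift_inv =
  fixes k :: nat and M :: "(nat \<Rightarrow> nat) measure"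
  assumes inv: "M \<in> inv_measures k"
begin

lemma sets_M: "sets M = sets (shift_space k)"
  using inv by (simp add: inv_measures_def)

lemma space_M [simp]: "space M = fullshift k"
  using sets_eq_imp_space_eq[OF sets_M] by simp

sublocale prob_space M
  using inv by (simp add: inv_measures_def)

sublocale mpt M shift
proof unfold_locales
  show T: "shift \<in> M \<rightarrow>\<^sub>M M"
    using shift_measurable measurable_cong_sets[OF sets_M sets_M] by simp
  show "distr M M shift = M"
  proof (rule measure_eqI)
    fix A assume A: "A \<in> sets (distr M M shift)"
    then show "emeasure (distr M M shift) A = emeasure M A"
      using inv T by (simp add: emeasure_distr inv_measures_def)
  qed simp
qed

lemma cset_sets [measurable]: "cset k m U \<in> sets M"
  using cset_measurable sets_M by simp

lemma simple_function_pre_comp: "simple_function M (\<lambda>x. g (pre n x))"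
proof -
  have "simple_function M (\<lambda>x. x 0)"
  proof -
    have "finite ((\<lambda>x. x 0) ` space M)"
      by (rule finite_subset[of _ "{..<k}"]) (auto simp: fullshift_def)
    moreover have "(\<lambda>x. x 0) -` {s} \<inter> space M = cset k 1 {[s]}" for s
      by (auto simp: cset_def pre_eq)
    ultimately show ?thesis by (auto simp: simple_function_def)
  qed
  then have "simple_function M (pre n)" by (rule simple_function_itin)
  then show ?thesis using simple_function_compose[of M "pre n" g] by (simp add: comp_def)
qed

lemmas simple_function_pre = simple_function_pre_comp[of "\<lambda>w. w"]

lemma simple_function_coord: "simple_function M (\<lambda>x. x 0)"
  using simple_function_pre_comp[of hd 1] by (simp add: pre_eq)

end

section \<open>The generator theorem\<close>

text \<open>Lets the total weight of independent guesses for \<open>n\<close> symbols factor into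
  one sum per symbol.\<close>

lemma sum_lists_prod:
  fixes g :: "nat \<Rightarrow> 'b \<Rightarrow> real"
  assumes "finite S"
  shows "(\<Sum>p\<in>{p. set p \<subseteq> S \<and> length p = n}. \<Prod>i<n. g i (p ! i)) = (\<Prod>i<n. \<Sum>s\<in>S. g i s)"
proof (induction n arbitrary: g)
  case 0
  have "{p. set p \<subseteq> S \<and> length p = 0} = {[]}" by auto
  then show ?case by simp
next
  case (Suc n)
  let ?W = "{p. set p \<subseteq> S \<and> length p = n}"
  have eq: "{p. set p \<subseteq> S \<and> length p = Suc n} = (\<lambda>(s, p). s # p) ` (S \<times> ?W)"
    by (auto simp: length_Suc_conv image_iff)
  have inj: "inj_on (\<lambda>(s, p). s # p) (S \<times> ?W)" by (auto intro: inj_onI)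
  have "(\<Sum>p\<in>{p. set p \<subseteq> S \<and> length p = Suc n}. \<Prod>i<Suc n. g i (p ! i))
      = (\<Sum>(s, p)\<in>S \<times> ?W. g 0 s * (\<Prod>i<n. g (Suc i) (p ! i)))"
    unfolding eq by (subst sum.reindex[OF inj], rule sum.cong)
      (auto simp: prod.lessThan_Suc_shift simp del: prod.lessThan_Suc)
  also have "\<dots> = (\<Sum>s\<in>S. g 0 s) * (\<Sum>p\<in>?W. \<Prod>i<n. g (Suc i) (p ! i))"
    by (simp add: sum_product sum.cartesian_product)
  also have "\<dots> = (\<Sum>s\<in>S. g 0 s) * (\<Prod>i<n. \<Sum>s\<in>S. g (Suc i) s)"
    by (simp only: Suc[of "\<lambda>i. g (Suc i)"])
  finally show ?case by (simp add: prod.lessThan_Suc_shift del: prod.lessThan_Suc)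
qed

context shift_inv
begin

text \<open>A point's \<open>X\<close>-itinerary is guessed from its word of length \<open>n + m\<close> by decoding each window of length
  \<open>m\<close> with \<open>Y\<close>, a guess being trusted with probability \<open>1 - e\<close>.  Comparing with the resulting joint
  distribution in Gibbs' inequality avoids conditional entropies.\<close>

lemma ent_le_generator:
  assumes X: "simple_function M X"
    and dis: "measure M {x \<in> space M. X x \<noteq> Y (pre m x)} \<le> d"
    and e: "0 < e" "e < 1"
  shows "ent M (itin shift X n)
    \<le> ent M (pre (n + m)) + real n * (- ln (1 - e) + d * ln (real (card (X ` space M)) / e))"
proof -
  let ?S = "X ` space M" and ?R = "pre (n + m) ` space M"
  let ?c = "real (card ?S)"
  have finS: "finite ?S" using X by (rule simple_functionD)
  have finR: "finite ?R" using simple_function_pre by (rule simple_functionD)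
  have c: "1 \<le> ?c" using not_empty finS by (simp add: Suc_le_eq card_gt_0_iff)
  \<comment> \<open>The wrong symbols share weight at most \<open>e\<close>, and none gets weight 0,
    so a wrong guess costs only \<open>ln (?c / e)\<close>.\<close>
  define r where "r s u = (if s = Y u then 1 - e else e / ?c)" for s u
  have r_pos: "0 < r s u" for s u using e c by (simp add: r_def)
  have r_sum: "(\<Sum>s\<in>?S. r s u) \<le> 1" for u
  proof -
    have "(\<Sum>s\<in>?S. r s u) \<le> (\<Sum>s\<in>?S. (if s = Y u then 1 - e else 0) + e / ?c)"
      using e c by (intro sum_mono) (simp add: r_def)
    also have "\<dots> \<le> 1 - e + ?c * (e / ?c)"
      using e finS by (simp add: sum.distrib)
    also have "\<dots> = 1" using c by simp
    finally show ?thesis .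
  qed
  \<comment> \<open>The windows start before \<open>n\<close> and have length \<open>m\<close>, so
    \<open>n + m\<close> letters contain them all.\<close>
  define Z where "Z x = (itin shift X n x, pre (n + m) x)" for x
  define q where "q = (\<lambda>(p, w). fib M (pre (n + m)) w * (\<Prod>i<n. r (p ! i) (take m (drop i w))))"
  have Z: "simple_function M Z"
    unfolding Z_def using simple_function_itin[OF X] simple_function_pre by (rule simple_function_Pair)
  have window: "take m (drop i (pre (n + m) x)) = pre m ((shift ^^ i) x)" if "i < n" for i x
    using that by (auto simp: pre_eq shift_funpow list_eq_iff_nth_eq)
  have "ent M (itin shift X n) \<le> ent M Z"
    using ent_comp_le[OF Z, of fst] by (simp add: Z_def)
  also have "\<dots> \<le> (\<integral>x. - ln (q (Z x)) \<partial>M)"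
  proof (rule ent_le_cross[OF Z])
    let ?W = "{p. set p \<subseteq> ?S \<and> length p = n}"
    have "(\<Sum>s\<in>Z ` space M. q s) \<le> (\<Sum>s\<in>?W \<times> ?R. q s)"
    proof (rule sum_mono2)
      show "finite (?W \<times> ?R)" using finite_lists_length_eq[OF finS] finR by simp
      show "Z ` space M \<subseteq> ?W \<times> ?R"
        using funpow_space by (auto simp: Z_def itin_def)
    qed (auto simp: q_def fib_nonneg intro!: mult_nonneg_nonneg prod_nonneg less_imp_le[OF r_pos])
    also have "\<dots> = (\<Sum>w\<in>?R. \<Sum>p\<in>?W. q (p, w))"
      by (subst sum.swap) (simp add: sum.cartesian_product')
    also have "\<dots> = (\<Sum>w\<in>?R. fib M (pre (n + m)) w * (\<Prod>i<n. \<Sum>s\<in>?S. r s (take m (drop i w))))"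
      using sum_lists_prod[OF finS, where n = n and g = "\<lambda>i s. r s (take m (drop i w))" for w]
      by (simp add: q_def sum_distrib_left[symmetric])
    also have "\<dots> \<le> (\<Sum>w\<in>?R. fib M (pre (n + m)) w * 1)"
      using r_sum by (intro sum_mono mult_left_mono fib_nonneg prod_le_1)
        (auto intro!: sum_nonneg less_imp_le[OF r_pos])
    also have "\<dots> = 1" using sum_fib[OF simple_function_pre] by simp
    finally show "(\<Sum>s\<in>Z ` space M. q s) \<le> 1" .
  next
    fix s assume s: "s \<in> Z ` space M" and p: "0 < fib M Z s"
    have "fib M Z s \<le> fib M (pre (n + m)) (snd s)"
      unfolding fib_def by (intro finite_measure_mono simple_function_fibre simple_function_pre) (auto simp: Z_def)
    then show "0 < q s" using p by (auto simp: q_def split_beta intro!: mult_pos_pos prod_pos r_pos)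
  qed (auto simp: q_def fib_nonneg intro!: mult_nonneg_nonneg prod_nonneg less_imp_le[OF r_pos])
  also have "\<dots> = (\<integral>x. - ln (fib M (pre (n + m)) (pre (n + m) x))
      + (\<Sum>i<n. - ln (r (X ((shift ^^ i) x)) (pre m ((shift ^^ i) x)))) \<partial>M)"
  proof (rule integral_cong_AE)
    show "(\<lambda>x. - ln (q (Z x))) \<in> borel_measurable M"
      using integrable_simple_comp[OF Z, of "\<lambda>z. - ln (q z)"] by (rule borel_measurable_integrable)
    show "(\<lambda>x. - ln (fib M (pre (n + m)) (pre (n + m) x))
      + (\<Sum>i<n. - ln (r (X ((shift ^^ i) x)) (pre m ((shift ^^ i) x))))) \<in> borel_measurable M"
    proof (intro borel_measurable_add borel_measurable_sum)
      show "(\<lambda>x. - ln (fib M (pre (n + m)) (pre (n + m) x))) \<in> borel_measurable M"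
        using integrable_simple_comp[OF simple_function_pre, of "\<lambda>z. - ln (fib M (pre (n + m)) z)"]
        by (rule borel_measurable_integrable)
      show "(\<lambda>x. - ln (r (X ((shift ^^ i) x)) (pre m ((shift ^^ i) x)))) \<in> borel_measurable M" for i
        using integrable_simple_comp[OF simple_function_funpow[OF simple_function_Pair[OF X simple_function_pre]],
            of "\<lambda>(s, u). - ln (r s u)" i m]
        by (simp add: borel_measurable_integrable)
    qed
    show "AE x in M. - ln (q (Z x)) = - ln (fib M (pre (n + m)) (pre (n + m) x))
      + (\<Sum>i<n. - ln (r (X ((shift ^^ i) x)) (pre m ((shift ^^ i) x))))"
      using AE_fib_pos[OF simple_function_pre, of "n + m"]
    proof eventually_elim
      case (elim x)
      have "q (Z x) = fib M (pre (n + m)) (pre (n + m) x)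
          * (\<Prod>i<n. r (X ((shift ^^ i) x)) (pre m ((shift ^^ i) x)))"
        by (simp add: q_def Z_def window nth_itin)
      moreover have "0 < (\<Prod>i<n. r (X ((shift ^^ i) x)) (pre m ((shift ^^ i) x)))"
        by (intro prod_pos) (simp add: r_pos)
      ultimately show ?case using elim
        by (simp add: ln_mult ln_prod r_pos less_imp_neq[OF r_pos, symmetric] sum_negf)
    qed
  qed
  also have "\<dots> = ent M (pre (n + m)) + (\<Sum>i<n. \<integral>x. - ln (r (X ((shift ^^ i) x)) (pre m ((shift ^^ i) x))) \<partial>M)"
  proof -
    have i1: "integrable M (\<lambda>x. - ln (fib M (pre (n + m)) (pre (n + m) x)))"
      using integrable_simple_comp[OF simple_function_pre, of "\<lambda>z. - ln (fib M (pre (n + m)) z)"] .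
    have i2: "integrable M (\<lambda>x. - ln (r (X ((shift ^^ i) x)) (pre m ((shift ^^ i) x))))" for i
      using integrable_simple_comp[OF simple_function_funpow[OF simple_function_Pair[OF X simple_function_pre]],
            of "\<lambda>(s, u). - ln (r s u)" i m] by simp
    show ?thesis
      using Bochner_Integration.integral_add[OF i1 Bochner_Integration.integrable_sum[of "{..<n}" M, OF i2]]
        Bochner_Integration.integral_sum[of "{..<n}" M, OF i2]
      by (simp only: ent_def)
  qed
  also have "(\<Sum>i<n. \<integral>x. - ln (r (X ((shift ^^ i) x)) (pre m ((shift ^^ i) x))) \<partial>M)
      = real n * (\<integral>x. - ln (r (X x) (pre m x)) \<partial>M)"
  proof -
    have "(\<lambda>x. - ln (r (X x) (pre m x))) \<in> borel_measurable M"
      using integrable_simple_comp[OF simple_function_Pair[OF X simple_function_pre],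
          of "\<lambda>(s, u). - ln (r s u)" m] by (simp add: borel_measurable_integrable)
    from integral_funpow[OF this] show ?thesis by simp
  qed
  \<comment> \<open>A right guess costs \<open>- ln (1 - e)\<close>, a wrong one
    \<open>ln (?c / e)\<close>. The first cost is nonnegative, so it may be charged at every
    point.\<close>
  also have "(\<integral>x. - ln (r (X x) (pre m x)) \<partial>M)
      \<le> (\<integral>x. - ln (1 - e) + indicator {x \<in> space M. X x \<noteq> Y (pre m x)} x * ln (?c / e) \<partial>M)"
  proof (rule integral_mono)
    have sets: "{x \<in> space M. X x \<noteq> Y (pre m x)} \<in> sets M"
      using simple_function_fibre[OF simple_function_compose2[OF X simple_function_pre, of "\<lambda>s u. s \<noteq> Y u" m], of True]
      by simp
    show "integrable M (\<lambda>x. - ln (1 - e) + indicator {x \<in> space M. X x \<noteq> Y (pre m x)} x * ln (?c / e))"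
      using sets by (auto simp: emeasure_eq_measure)
    show "integrable M (\<lambda>x. - ln (r (X x) (pre m x)))"
      using integrable_simple_comp[OF simple_function_Pair[OF X simple_function_pre],
          of "\<lambda>(s, u). - ln (r s u)" m] by simp
    show "- ln (r (X x) (pre m x)) \<le> - ln (1 - e) + indicator {x \<in> space M. X x \<noteq> Y (pre m x)} x * ln (?c / e)"
      if "x \<in> space M" for x
    proof -
      have "ln (e / ?c) = - ln (?c / e)" using e c by (simp add: ln_div)
      moreover have "ln (1 - e) \<le> 0" using e by simp
      ultimately show ?thesis using that by (simp add: r_def)
    qed
  qed
  also have "\<dots> = - ln (1 - e) + measure M {x \<in> space M. X x \<noteq> Y (pre m x)} * ln (?c / e)"
  proof -
    have sets: "{x \<in> space M. X x \<noteq> Y (pre m x)} \<in> sets M"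
      using simple_function_fibre[OF simple_function_compose2[OF X simple_function_pre, of "\<lambda>s u. s \<noteq> Y u" m], of True]
      by simp
    moreover have "{x \<in> fullshift k. X x \<noteq> Y (pre m x)} \<inter> fullshift k = {x \<in> fullshift k. X x \<noteq> Y (pre m x)}"
      by auto
    ultimately show ?thesis using prob_space by (simp add: emeasure_eq_measure)
  qed
  also have "\<dots> \<le> - ln (1 - e) + d * ln (?c / e)"
  proof -
    have "0 \<le> ln (?c / e)" using e c by (intro ln_ge_zero) (simp add: field_simps)
    then show ?thesis using dis by (intro add_left_mono mult_right_mono)
  qed
  finally show ?thesis by (simp add: mult_left_mono)
qed

text \<open>A partition is turned into a map by sending a point to the set of members that contain
  it, which avoids choosing labels.\<close>

lemma simple_function_cells:
  assumes fin: "finite P" and P: "P \<subseteq> sets M"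
  shows "simple_function M (\<lambda>x. {A \<in> P. x \<in> A})"
proof -
  let ?X = "\<lambda>x. {A \<in> P. x \<in> A}"
  have "finite (?X ` space M)" by (rule finite_subset[where B = "Pow P"]) (use fin in auto)
  moreover have "?X -` {?X y} \<inter> space M \<in> sets M" for y
  proof -
    have "?X -` {?X y} \<inter> space M = {x \<in> space M. \<forall>A\<in>P. x \<in> A \<longleftrightarrow> y \<in> A}" by blast
    also have "\<dots> \<in> sets M"
    proof (rule sets.sets_Collect_finite_All)
      fix A assume "A \<in> P"
      then have A: "A \<in> sets M" using P by blast
      have "{x \<in> space M. x \<in> A \<longleftrightarrow> y \<in> A} = (if y \<in> A then A else space M - A)"
        using sets.sets_into_space[OF A] by auto
      then show "{x \<in> space M. x \<in> A \<longleftrightarrow> y \<in> A} \<in> sets M"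
        using A sets.compl_sets[OF A] by (simp del: space_M)
    qed (rule fin)
    finally show ?thesis .
  qed
  ultimately show ?thesis by (auto simp: simple_function_def)
qed

lemma cells_decoder:
  assumes fin: "finite P" and P: "P \<subseteq> sets M" and d: "0 < d"
  obtains m Y where "measure M {x \<in> space M. {A \<in> P. x \<in> A} \<noteq> Y (pre m x)} \<le> d"
proof -
  \<comment> \<open>The added 1 keeps the quotient positive when \<open>P\<close> is empty.\<close>
  let ?d = "d / (real (card P) + 1)"
  have d': "0 < ?d" using d by simp
  have "\<exists>m U. measure M (sym_diff A (cset k m U)) < ?d" if "A \<in> P" for A
    using cset_approx[of "{M}" k A ?d] sets_M d' that P finite_measure_axioms by auto
  then obtain mm UU where mU: "\<And>A. A \<in> P \<Longrightarrow> measure M (sym_diff A (cset k (mm A) (UU A))) < ?d"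
    by metis
  \<comment> \<open>The sum is a common upper bound for the word lengths; \<open>take\<close>
    recovers each shorter word.\<close>
  define m where "m = sum mm P"
  define Y where "Y w = {A \<in> P. take (mm A) w \<in> UU A}" for w
  have le: "mm A \<le> m" if "A \<in> P" for A unfolding m_def using fin that by (rule member_le_sum[rotated 2]) simp
  have S: "sym_diff A (cset k (mm A) (UU A)) \<in> sets M" if "A \<in> P" for A using that P by auto
  have take: "take (mm A) (pre m x) = pre (mm A) x" if "A \<in> P" for A x
    using le[OF that] by (simp add: pre_eq take_map take_upt)
  have "{x \<in> space M. {A \<in> P. x \<in> A} \<noteq> Y (pre m x)} \<subseteq> (\<Union>A\<in>P. sym_diff A (cset k (mm A) (UU A)))"
    by (auto simp: Y_def take cset_def)
  then have "measure M {x \<in> space M. {A \<in> P. x \<in> A} \<noteq> Y (pre m x)}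
      \<le> measure M (\<Union>A\<in>P. sym_diff A (cset k (mm A) (UU A)))"
    using S fin by (intro finite_measure_mono) auto
  also have "\<dots> \<le> (\<Sum>A\<in>P. measure M (sym_diff A (cset k (mm A) (UU A))))"
    using S by (intro measure_UNION_le fin)
  also have "\<dots> \<le> (\<Sum>A\<in>P. ?d)" using mU by (intro sum_mono less_imp_le)
  also have "\<dots> = real (card P) * ?d" by simp
  also have "\<dots> \<le> (real (card P) + 1) * ?d" using d' by (intro mult_right_mono) auto
  also have "\<dots> = d" using add_nonneg_pos[of "real (card P)" 1] by simp
  finally show thesis by (rule that)
qed

text \<open>Kolmogorov-Sinai: the supremum is attained by the partition according to the first
  letter. For any partition the generator estimate adds at most \<open>t\<close> per step, and the
  \<open>m\<close> extra letters of the windows disappear in the rate.\<close>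

lemma ks_entropy_eq:
  assumes h: "(\<lambda>n. ent M (pre n) / real n) \<longlonglongrightarrow> h"
  shows "ks_entropy M shift = h"
proof -
  have "entropy_wrt M shift P \<le> h" if part: "is_partition M P" for P
  proof -
    have fin: "finite P" and P: "P \<subseteq> sets M" using part by (auto simp: is_partition_def)
    let ?X = "\<lambda>x. {A \<in> P. x \<in> A}"
    have X: "simple_function M ?X" using fin P by (rule simple_function_cells)
    obtain g where g: "(\<lambda>n. ent M (itin shift ?X n) / real n) \<longlonglongrightarrow> g" using ent_rate[OF X] .
    have "part_entropy M (join_part M shift P n) = ent M (itin shift ?X n)" for n
      by (rule part_entropy_join_part[OF part X]) blast
    then have "entropy_wrt M shift P = g" using limI[OF g] by (simp add: entropy_wrt_def)
    moreover have "g \<le> h"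
    proof (rule field_le_epsilon)
      fix t :: real assume t: "0 < t"
      \<comment> \<open>Both costs of the generator estimate get \<open>t / 2\<close>: first
        \<open>e\<close> is chosen with \<open>- ln (1 - e) = t / 2\<close>, and only then the
        decoder, whose admissible error depends on \<open>L\<close> and so on
        \<open>e\<close>.\<close>
      define e where "e = 1 - exp (- t / 2)"
      have e: "0 < e" "e < 1" using t by (simp_all add: e_def)
      define L where "L = ln (real (card (?X ` space M)) / e)"
      have "0 < t / (2 * (\<bar>L\<bar> + 1))" using t by simp
      then obtain m Y where Y: "measure M {x \<in> space M. ?X x \<noteq> Y (pre m x)} \<le> t / (2 * (\<bar>L\<bar> + 1))"
        by (rule cells_decoder[OF fin P])
      have kappa: "- ln (1 - e) + t / (2 * (\<bar>L\<bar> + 1)) * L \<le> t"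
      proof -
        have "L / (\<bar>L\<bar> + 1) \<le> 1" by (subst divide_le_eq_1_pos) linarith+
        then have "t / 2 * (L / (\<bar>L\<bar> + 1)) \<le> t / 2 * 1" using t by (intro mult_left_mono) auto
        moreover have "t / (2 * (\<bar>L\<bar> + 1)) * L = t / 2 * (L / (\<bar>L\<bar> + 1))"
          by simp
        moreover have "- ln (1 - e) = t / 2" by (simp add: e_def)
        ultimately show ?thesis by linarith
      qed
      have le: "ent M (itin shift ?X n) \<le> ent M (pre (n + m)) + real n * t" for n
      proof -
        have "ent M (itin shift ?X n) \<le> ent M (pre (n + m)) + real n * (- ln (1 - e) + t / (2 * (\<bar>L\<bar> + 1)) * L)"
          using ent_le_generator[OF X Y e] by (simp only: L_def)
        also have "\<dots> \<le> ent M (pre (n + m)) + real n * t"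
          using kappa by (intro add_left_mono mult_left_mono) auto
        finally show ?thesis .
      qed
      have ub: "ent M (itin shift ?X n) / real n
          \<le> (ent M (pre (n + m)) / real (n + m)) * (1 + real m / real n) + t" if n: "1 \<le> n" for n
      proof -
        have "(ent M (pre (n + m)) / real (n + m)) * (1 + real m / real n) = ent M (pre (n + m)) / real n"
        proof -
          have "1 + real m / real n = real (n + m) / real n" using n by (simp add: add_divide_distrib)
          moreover have "real (n + m) \<noteq> 0" using n by simp
          ultimately show ?thesis by (simp del: of_nat_add)
        qed
        then show ?thesis using le[of n] n by (simp add: field_simps)
      qed
      have "(\<lambda>n. (ent M (pre (n + m)) / real (n + m)) * (1 + real m / real n) + t) \<longlonglongrightarrow> h * (1 + 0) + t"
        using LIMSEQ_ignore_initial_segment[OF h, of m] lim_const_over_n[of "real m"]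
        by (intro tendsto_intros) auto
      then show "g \<le> h + t"
        using LIMSEQ_le[OF g] ub by auto
    qed
    ultimately show ?thesis by simp
  qed
  moreover have "\<exists>P. is_partition M P \<and> entropy_wrt M shift P = h"
  proof -
    let ?c = "\<lambda>a. {x \<in> fullshift k. x 0 = a}"
    let ?P = "?c ` {..<k}"
    have c: "?c a = cset k 1 {[a]}" for a by (auto simp: cset_def pre_eq)
    have part: "is_partition M ?P"
      unfolding is_partition_def
    proof (intro conjI)
      show "?P \<subseteq> sets M" unfolding c by auto
      show "\<Union>?P = space M" by (auto simp: fullshift_def)
    qed auto
    have "part_entropy M (join_part M shift ?P n) = ent M (pre n)" for n
    proof (rule part_entropy_join_part[OF part simple_function_coord])
      fix x z assume "x \<in> space M" "z \<in> space M"
      then show "x 0 = z 0 \<longleftrightarrow> (\<forall>A\<in>?P. x \<in> A \<longleftrightarrow> z \<in> A)" by (auto simp: fullshift_def)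
    qed
    then have "entropy_wrt M shift ?P = h" using limI[OF h] by (simp add: entropy_wrt_def)
    then show ?thesis using part by blast
  qed
  ultimately show ?thesis
    unfolding ks_entropy_def by (intro cSup_eq_maximum) auto
qed

end

section \<open>The variational principle for quasi-Bernoulli measures\<close>

definition words :: "nat \<Rightarrow> nat \<Rightarrow> nat list set" where
  "words k n = {w. set w \<subseteq> {..<k} \<and> length w = n}"

lemma finite_words: "finite (words k n)"
  unfolding words_def by (rule finite_lists_length_eq) simp

lemma pre_in_words: "x \<in> fullshift k \<Longrightarrow> pre n x \<in> words k n"
  by (auto simp: words_def pre_eq fullshift_def)

text \<open>The filling letter 0 belongs to the alphabet as soon as
  \<open>k \<ge> 1\<close>.\<close>

definition pad :: "nat list \<Rightarrow> nat \<Rightarrow> nat" where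
  "pad w i = (if i < length w then w ! i else 0)"

lemma pre_pad: "pre (length w) (pad w) = w"
  by (auto simp: pre_eq_iff pad_def)

lemma pad_fullshift: "1 \<le> k \<Longrightarrow> set w \<subseteq> {..<k} \<Longrightarrow> pad w \<in> fullshift k"
  by (auto simp: fullshift_def pad_def subset_iff)

lemma pre_image: "1 \<le> k \<Longrightarrow> pre n ` fullshift k = words k n"
proof (intro equalityI subsetI)
  fix w assume "1 \<le> k" "w \<in> words k n"
  then show "w \<in> pre n ` fullshift k"
    using pre_pad[of w] pad_fullshift[of k w] by (intro image_eqI[of _ _ "pad w"]) (auto simp: words_def)
qed (auto intro: pre_in_words)

lemma words_append: "u \<in> words k n \<Longrightarrow> v \<in> words k m \<Longrightarrow> u @ v \<in> words k (n + m)"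
  by (auto simp: words_def)

text \<open>Mass of the cylinder of a word; its length is read off from the word, so concatenation
  formulas carry no indices.\<close>

definition wm :: "(nat \<Rightarrow> nat) measure \<Rightarrow> nat list \<Rightarrow> real" where
  "wm M w = fib M (pre (length w)) w"

context shift_inv
begin

lemma k_pos: "1 \<le> k"
proof (rule ccontr)
  assume "\<not> 1 \<le> k"
  then have "space M = {}" by (simp add: fullshift_def)
  then show False using not_empty by blast
qed

lemma wm_eq: "w \<in> words k n \<Longrightarrow> wm M w = measure M (cset k n {w})"
  by (auto simp: wm_def fib_def cset_def words_def)

lemma wm_pre: "wm M (pre n x) = fib M (pre n) (pre n x)"
  by (simp add: wm_def)

lemma wm_Nil: "wm M [] = 1"
  using prob_space by (simp add: wm_def fib_def)

lemma measure_cset: "measure M (cset k n U) = (\<Sum>w\<in>words k n \<inter> U. wm M w)"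
proof -
  have "measure M (cset k n U) = (\<integral>x. indicator (cset k n U) x \<partial>M)"
    using sets.sets_into_space[OF cset_sets, of n U] by (simp add: Int_absorb2)
  also have "\<dots> = (\<integral>x. indicator U (pre n x) \<partial>M)"
    by (rule Bochner_Integration.integral_cong) (auto simp: cset_def indicator_def)
  also have "\<dots> = (\<Sum>w\<in>words k n. indicator U w * fib M (pre n) w)"
    using integral_simple_comp[OF simple_function_pre, of "indicator U" n] pre_image[OF k_pos] by simp
  also have "\<dots> = (\<Sum>w\<in>words k n. if w \<in> U then wm M w else 0)"
    by (intro sum.cong) (auto simp: wm_def words_def)
  finally show ?thesis using finite_words by (simp add: sum.inter_restrict)
qed

lemma sum_wm: "(\<Sum>w\<in>words k n. wm M w) = 1"
  using measure_cset[of n UNIV] prob_space by (simp add: cset_def)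

end

section \<open>Quasi-Bernoulli measures: mixing and ergodicity\<close>

locale quasi_bernoulli = shift_inv +
  fixes C :: real
  assumes pos: "set w \<subseteq> {..<k} \<Longrightarrow> 0 < wm M w"
    and lower: "set u \<subseteq> {..<k} \<Longrightarrow> set v \<subseteq> {..<k} \<Longrightarrow> exp (- C) * (wm M u * wm M v) \<le> wm M (u @ v)"
    and upper: "set u \<subseteq> {..<k} \<Longrightarrow> set v \<subseteq> {..<k} \<Longrightarrow> wm M (u @ v) \<le> exp C * (wm M u * wm M v)"
begin

definition lw :: "nat \<Rightarrow> (nat \<Rightarrow> nat) \<Rightarrow> real" where
  "lw n x = ln (wm M (pre n x))"

lemma pre_pos: "x \<in> fullshift k \<Longrightarrow> 0 < wm M (pre n x)"
  using pos pre_in_words by (auto simp: words_def)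

lemma lw_add:
  assumes x: "x \<in> fullshift k"
  shows "\<bar>lw (n + m) x - lw n x - lw m ((shift ^^ n) x)\<bar> \<le> C"
proof -
  let ?u = "pre n x" and ?v = "pre m ((shift ^^ n) x)"
  have y: "(shift ^^ n) x \<in> fullshift k" using funpow_space[of x n] x by simp
  have W: "set ?u \<subseteq> {..<k}" "set ?v \<subseteq> {..<k}"
    using pre_in_words[OF x] pre_in_words[OF y] by (auto simp: words_def)
  have p: "0 < wm M ?u" "0 < wm M ?v" "0 < wm M (?u @ ?v)" using pos W by auto
  have "ln (exp (- C) * (wm M ?u * wm M ?v)) \<le> ln (wm M (?u @ ?v))"
    using lower[OF W] p by (subst ln_le_cancel_iff) auto
  moreover have "ln (wm M (?u @ ?v)) \<le> ln (exp C * (wm M ?u * wm M ?v))"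
    using upper[OF W] p by (subst ln_le_cancel_iff) auto
  ultimately show ?thesis using p by (simp add: lw_def itin_add ln_mult)
qed

lemma C_nonneg: "0 \<le> C"
  using lower[of "[]" "[]"] by (simp add: wm_Nil)

text \<open>One more letter changes \<open>lw\<close> by the logarithm of a letter mass, up to
  \<open>C\<close>; this bounds the growth per letter.\<close>

definition K where "K = C + Max ((\<lambda>a. \<bar>ln (wm M [a])\<bar>) ` {..<k})"

lemma lw_bound:
  assumes x: "x \<in> fullshift k"
  shows "\<bar>lw n x\<bar> \<le> K * real n"
proof (induction n)
  case 0
  then show ?case by (simp add: lw_def wm_Nil)
next
  case (Suc n)
  have "(shift ^^ n) x 0 < k" using x by (simp add: shift_funpow fullshift_def)
  then have "\<bar>lw 1 ((shift ^^ n) x)\<bar> \<le> Max ((\<lambda>a. \<bar>ln (wm M [a])\<bar>) ` {..<k})"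
    by (intro Max_ge) (auto simp: lw_def pre_eq)
  then show ?case using lw_add[OF x, of n 1] Suc by (simp add: K_def algebra_simps)
qed

lemma lw_measurable: "shift_inv k M' \<Longrightarrow> lw n \<in> borel_measurable M'"
  using prob_space.integrable_simple_comp[OF _ shift_inv.simple_function_pre[of k M' n], of "\<lambda>w. ln (wm M w)"]
  by (auto simp: lw_def[abs_def] shift_inv_def inv_measures_def intro: borel_measurable_integrable)

lemma lw_cocycle:
  assumes "shift_inv k M'"
  shows "almost_additive_cocycle M' shift lw C K"
proof -
  interpret M': shift_inv k M' by fact
  show ?thesis
    by unfold_locales (use lw_measurable[OF assms] lw_add lw_bound in auto)
qed

text \<open>The word inequalities are summed over all pairs of words, splitting at \<open>n\<close>
  being a bijection. Sets of words are needed for ergodicity and for the image measure, where a word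
  of \<open>Y\<close> lifts to a set of words.\<close>

lemma mixing:
  fixes n m U V
  defines "B \<equiv> cset k (n + m) {w. take n w \<in> U \<and> drop n w \<in> V}"
  shows "exp (- C) * (measure M (cset k n U) * measure M (cset k m V)) \<le> measure M B"
    and "measure M B \<le> exp C * (measure M (cset k n U) * measure M (cset k m V))"
proof -
  let ?A = "words k (n + m) \<inter> {w. take n w \<in> U \<and> drop n w \<in> V}"
  let ?P = "(words k n \<inter> U) \<times> (words k m \<inter> V)"
  have inj: "inj_on (\<lambda>(u, v). u @ v) ?P"
    by (rule inj_on_inverseI[where g = "\<lambda>w. (take n w, drop n w)"]) (auto simp: words_def)
  have im: "(\<lambda>(u, v). u @ v) ` ?P = ?A"
  proof (intro equalityI subsetI)
    fix w assume w: "w \<in> ?A"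
    have "take n w \<in> words k n \<inter> U" "drop n w \<in> words k m \<inter> V"
      using w set_take_subset[of n w] set_drop_subset[of n w] by (auto simp: words_def)
    then show "w \<in> (\<lambda>(u, v). u @ v) ` ?P"
      by (intro image_eqI[of _ _ "(take n w, drop n w)"]) auto
  qed (auto simp: words_def)
  have B: "measure M B = (\<Sum>(u, v)\<in>?P. wm M (u @ v))"
    unfolding B_def measure_cset im[symmetric] sum.reindex[OF inj] by (simp add: split_beta comp_def)
  have P: "measure M (cset k n U) * measure M (cset k m V) = (\<Sum>(u, v)\<in>?P. wm M u * wm M v)"
    unfolding measure_cset by (simp add: sum_product sum.cartesian_product)
  show "exp (- C) * (measure M (cset k n U) * measure M (cset k m V)) \<le> measure M B"
    unfolding B P sum_distrib_left by (intro sum_mono) (auto intro!: lower simp: words_def)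
  show "measure M B \<le> exp C * (measure M (cset k n U) * measure M (cset k m V))"
    unfolding B P sum_distrib_left by (intro sum_mono) (auto intro!: upper simp: words_def)
qed

text \<open>For \<open>G\<close> approximating \<open>E\<close>, let \<open>H\<close> consist of the
  points outside \<open>G\<close> at time 0 and inside it at time \<open>m\<close>. Mixing bounds
  the mass of \<open>H\<close> below by \<open>exp (- C) * ((1 - g) * g)\<close>, where
  \<open>g\<close> is the mass of \<open>G\<close>, while invariance of \<open>E\<close> makes
  \<open>H\<close> small. In the limit \<open>p * (1 - p) = 0\<close> for the mass \<open>p\<close>
  of \<open>E\<close>.\<close>

lemma ergodic:
  assumes E: "E \<in> sets M" and invE: "\<And>x. x \<in> fullshift k \<Longrightarrow> shift x \<in> E \<longleftrightarrow> x \<in> E"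
  shows "measure M E = 0 \<or> measure M E = 1"
proof -
  let ?p = "measure M E"
  have bound: "?p * (1 - ?p) \<le> (2 * exp C + 2) * d" if d: "0 < d" for d
  proof -
    obtain m U where U: "measure M (sym_diff E (cset k m U)) < d"
      using cset_approx[of "{M}" k E d] E sets_M d finite_measure_axioms by auto
    define G where "G = cset k m U"
    define S where "S = sym_diff E G"
    have G: "G \<in> sets M" and S: "S \<in> sets M" using E by (auto simp: G_def S_def)
    have Sd: "measure M S < d" using U by (simp add: S_def G_def)
    define H where "H = cset k (m + m) {w. take m w \<in> - U \<and> drop m w \<in> U}"
    have Hs: "H \<in> sets M" by (simp add: H_def)
    let ?g = "measure M G"
    have Hm: "exp (- C) * ((1 - ?g) * ?g) \<le> measure M H"
    proof -
      have "measure M (cset k m (- U)) = 1 - ?g"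
        using prob_compl[OF G] by (simp add: G_def cset_Compl)
      then show ?thesis using mixing(1)[of m "- U" m U] by (simp add: G_def H_def)
    qed
    have invE': "(shift ^^ n) x \<in> E \<longleftrightarrow> x \<in> E" if "x \<in> fullshift k" for n x
      using that funpow_space by (induction n) (auto simp: invE)
    \<comment> \<open>A point of \<open>H\<close> changes its membership in \<open>G\<close> after
      \<open>m\<close> steps but not its membership in \<open>E\<close>, so \<open>E\<close> and
      \<open>G\<close> disagree at one of the two times.\<close>
    have "H \<subseteq> S \<union> {x \<in> space M. (shift ^^ m) x \<in> S}"
    proof
      fix x assume "x \<in> H"
      then have x: "x \<in> fullshift k" "pre m x \<notin> U" "pre m ((shift ^^ m) x) \<in> U"
        by (auto simp: H_def cset_def itin_add)
      have y: "(shift ^^ m) x \<in> fullshift k" using funpow_space[of x m] x by simp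
      then have "x \<notin> G" "(shift ^^ m) x \<in> G" using x by (auto simp: G_def cset_def)
      then show "x \<in> S \<union> {x \<in> space M. (shift ^^ m) x \<in> S}"
        using invE'[OF x(1), of m] x by (auto simp: S_def)
    qed
    moreover have T: "{x \<in> space M. (shift ^^ m) x \<in> S} \<in> sets M"
      using measurable_sets[OF funpow_measurable S, of m] by (simp add: vimage_def Int_def conj_commute)
    ultimately have "measure M H \<le> measure M (S \<union> {x \<in> space M. (shift ^^ m) x \<in> S})"
      using S by (intro finite_measure_mono) auto
    also have "\<dots> \<le> measure M S + measure M {x \<in> space M. (shift ^^ m) x \<in> S}"
      by (rule measure_Un_le[OF S T])
    also have "\<dots> \<le> 2 * d" using measure_funpow[OF S, of m] Sd by simp
    finally have "exp (- C) * ((1 - ?g) * ?g) \<le> 2 * d" using Hm by simp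
    then have g: "(1 - ?g) * ?g \<le> 2 * exp C * d" by (simp add: exp_minus field_simps)
    have "?p \<le> measure M (G \<union> S)" using G S by (intro finite_measure_mono) (auto simp: S_def)
    then have pg: "?p \<le> ?g + d" using measure_Un_le[OF G S] Sd by simp
    have "?g \<le> measure M (E \<union> S)" using E S by (intro finite_measure_mono) (auto simp: S_def)
    then have gp: "?g \<le> ?p + d" using measure_Un_le[OF E S] Sd by simp
    have "?p * (1 - ?p) - ?g * (1 - ?g) = (?p - ?g) * (1 - ?p - ?g)" by (simp add: algebra_simps)
    also have "\<dots> \<le> \<bar>?p - ?g\<bar> * \<bar>1 - ?p - ?g\<bar>" by (metis abs_ge_self abs_mult)
    also have "\<dots> \<le> d * 2"
    proof (rule mult_mono)
      show "\<bar>?p - ?g\<bar> \<le> d" using pg gp by simp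
      have "?p \<le> 1" "?g \<le> 1" "0 \<le> ?p" "0 \<le> ?g" by auto
      then show "\<bar>1 - ?p - ?g\<bar> \<le> 2" by linarith
    qed (use d in auto)
    finally show ?thesis using g by (simp add: algebra_simps)
  qed
  have "?p * (1 - ?p) \<le> 0"
  proof (rule field_le_epsilon)
    fix e :: real assume e: "0 < e"
    have c: "0 < 2 * exp C + 2" by (simp add: add_pos_pos)
    have "?p * (1 - ?p) \<le> (2 * exp C + 2) * (e / (2 * exp C + 2))"
      using bound[of "e / (2 * exp C + 2)"] e c by simp
    then show "?p * (1 - ?p) \<le> 0 + e" using c by simp
  qed
  moreover have "0 \<le> ?p" "?p \<le> 1" by auto
  ultimately have "?p * (1 - ?p) = 0" by (intro antisym mult_nonneg_nonneg) auto
  then show ?thesis by simp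
qed

end

section \<open>Relative entropy with respect to a quasi-Bernoulli measure\<close>

locale relative_to_qb = quasi_bernoulli k M C + M': shift_inv k M' for k M C M'
begin

sublocale lw: almost_additive_cocycle M' shift lw C K
  by (rule lw_cocycle) (rule M'.shift_inv_axioms)

text \<open>The Kullback-Leibler divergence of the law of the \<open>n\<close>-prefix under
  \<open>M'\<close> from that under \<open>M\<close>.\<close>

definition rel_ent :: "nat \<Rightarrow> real" where
  "rel_ent n = - ent M' (pre n) - (\<integral>x. lw n x \<partial>M')"

text \<open>The distribution compared with gives \<open>M\<close> weight \<open>1 / (2 b)\<close> on the cylinder set and \<open>1 / 2\<close> off it;
  this shows that \<open>M'\<close> cannot give much mass to a set that is small for \<open>M\<close>.\<close>

lemma ent_tilted:
  assumes b: "measure M (cset k n U) \<le> b" "0 < b"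
  shows "- measure M' (cset k n U) * ln b \<le> rel_ent n + ln 2"
proof -
  \<comment> \<open>Each half of the total weight is at most 1/2, the half on \<open>U\<close>
    because \<open>M\<close> gives the cylinder set mass at most \<open>b\<close>.\<close>
  define q where "q w = wm M w * (if w \<in> U then 1 / (2 * b) else 1 / 2)" for w
  have im: "pre n ` space M' = words k n" using pre_image[OF k_pos] by simp
  have "ent M' (pre n) \<le> (\<integral>x. - ln (q (pre n x)) \<partial>M')"
  proof (rule M'.ent_le_cross[OF M'.simple_function_pre])
    have "(\<Sum>w\<in>words k n. q w) = (\<Sum>w\<in>words k n \<inter> U. q w) + (\<Sum>w\<in>words k n - U. q w)"
      using sum.Int_Diff[OF finite_words, of q k n U] by simp
    also have "(\<Sum>w\<in>words k n \<inter> U. q w) = measure M (cset k n U) * (1 / (2 * b))"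
      by (simp only: measure_cset sum_distrib_right) (simp add: q_def)
    also have "(\<Sum>w\<in>words k n - U. q w) = measure M (cset k n (- U)) * (1 / 2)"
      by (simp only: measure_cset sum_distrib_right Diff_eq) (simp add: q_def)
    also have "measure M (cset k n U) * (1 / (2 * b)) \<le> b * (1 / (2 * b))"
      using b by (intro mult_right_mono) auto
    also have "measure M (cset k n (- U)) * (1 / 2) \<le> 1 * (1 / 2)"
      by (intro mult_right_mono) auto
    finally show "(\<Sum>w\<in>pre n ` space M'. q w) \<le> 1" using b im by simp
  qed (use b in \<open>auto simp: q_def pre_pos less_imp_le\<close>)
  also have "\<dots> = (\<integral>x. - lw n x + ln 2 + indicator (cset k n U) x * ln b \<partial>M')"
  proof (rule Bochner_Integration.integral_cong[OF refl])
    fix x assume "x \<in> space M'"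
    then have "0 < wm M (pre n x)" "x \<in> fullshift k" using pre_pos by auto
    then show "- ln (q (pre n x)) = - lw n x + ln 2 + indicator (cset k n U) x * ln b"
      using b by (auto simp: q_def lw_def cset_def ln_mult ln_div indicator_def)
  qed
  also have "\<dots> = - (\<integral>x. lw n x \<partial>M') + ln 2 + measure M' (cset k n U) * ln b"
    using lw.integrable_a[of n] M'.cset_sets[of n U] M'.prob_space sets.sets_into_space[OF M'.cset_sets[of n U]]
    by (simp add: M'.emeasure_eq_measure Int_absorb2)
  finally show ?thesis by (simp add: rel_ent_def)
qed

lemma rel_ent_nonneg: "0 \<le> rel_ent n"
proof -
  have im: "pre n ` space M' = words k n" using pre_image[OF k_pos] by simp
  have "ent M' (pre n) \<le> (\<integral>x. - ln (wm M (pre n x)) \<partial>M')"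
  proof (rule M'.ent_le_cross[OF M'.simple_function_pre])
    show "(\<Sum>w\<in>pre n ` space M'. wm M w) \<le> 1" unfolding im by (simp add: sum_wm)
  qed (auto simp: pre_pos less_imp_le)
  then show ?thesis by (simp add: rel_ent_def lw_def)
qed

text \<open>Prefix entropy is subadditive without error; the constant \<open>C\<close> comes from
  \<open>lw\<close> alone.\<close>

lemma rel_ent_superadditive: "rel_ent n + rel_ent m - C \<le> rel_ent (n + m)"
proof -
  have i: "integrable M' (\<lambda>x. lw m ((shift ^^ n) x))"
    using integrable_distr[OF M'.funpow_measurable, of n "lw m"] lw.integrable_a[of m] M'.distr_funpow by simp
  have "(\<integral>x. lw (n + m) x \<partial>M') \<le> (\<integral>x. lw n x + lw m ((shift ^^ n) x) + C \<partial>M')"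
  proof (rule integral_mono)
    show "lw (n + m) x \<le> lw n x + lw m ((shift ^^ n) x) + C" if "x \<in> space M'" for x
      using lw_add[of x n m] that by simp
  qed (use i lw.integrable_a in auto)
  also have "\<dots> = (\<integral>x. lw n x \<partial>M') + (\<integral>x. lw m x \<partial>M') + C"
    using i lw.integrable_a M'.integral_funpow[OF lw.meas[of m], of n] M'.prob_space by simp
  finally show ?thesis
    using M'.ent_itin_subadditive[OF M'.simple_function_coord, of n m] by (simp add: rel_ent_def)
qed

lemma free_energy_limit:
  "(\<lambda>n. - rel_ent n / real n) \<longlonglongrightarrow> ks_entropy M' shift + (\<integral>x. lw.ulim x \<partial>M')"
proof -
  obtain h where h: "(\<lambda>n. ent M' (pre n) / real n) \<longlonglongrightarrow> h"
    using M'.ent_rate[OF M'.simple_function_coord] .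
  have "(\<lambda>n. ent M' (pre n) / real n + (\<integral>x. lw n x \<partial>M') / real n) \<longlonglongrightarrow> h + (\<integral>x. lw.ulim x \<partial>M')"
    by (intro tendsto_add h lw.integral_ulim)
  then show ?thesis
    unfolding M'.ks_entropy_eq[OF h] by (simp add: rel_ent_def add_divide_distrib[symmetric] add.commute)
qed

lemma free_energy_le: "ks_entropy M' shift + (\<integral>x. lw.ulim x \<partial>M') \<le> 0"
  by (rule LIMSEQ_le_const2[OF free_energy_limit]) (auto intro!: exI[of _ 0] divide_nonneg_nonneg simp: rel_ent_nonneg)

text \<open>By superadditivity up to \<open>C\<close>, the limit 0 of \<open>- rel_ent n / n\<close>
  is at most \<open>(C - rel_ent n) / n\<close> for every \<open>n \<ge> 1\<close>. Here a vanishing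
  rate becomes a bound at each length.\<close>

lemma rel_ent_bounded:
  assumes eq: "ks_entropy M' shift + (\<integral>x. lw.ulim x \<partial>M') = 0"
  shows "rel_ent n \<le> C"
proof (cases "n = 0")
  case True
  have "rel_ent 0 = 0" using M'.prob_space by (simp add: rel_ent_def lw_def wm_Nil ent_def fib_def)
  then show ?thesis using True C_nonneg by simp
next
  case False
  have sub: "- rel_ent (n + m) \<le> - rel_ent n + - rel_ent m + C" for n m using rel_ent_superadditive[of n m] by simp
  have low: "- K * real n \<le> - rel_ent n" for n
  proof -
    have "(\<integral>x. - K * real n \<partial>M') \<le> (\<integral>x. lw n x \<partial>M')"
      by (rule integral_mono) (use lw_bound lw.integrable_a in \<open>auto simp: abs_le_iff minus_le_iff\<close>)
    then show ?thesis using M'.ent_nonneg[of "pre n"] M'.prob_space by (simp add: rel_ent_def)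
  qed
  obtain l where l: "(\<lambda>n. - rel_ent n / real n) \<longlonglongrightarrow> l" "\<And>n. n \<ge> 1 \<Longrightarrow> l \<le> (- rel_ent n + C) / real n"
    using fekete[of "\<lambda>n. - rel_ent n" C K, OF sub low] by blast
  have "l = 0" using LIMSEQ_unique[OF l(1) free_energy_limit] eq by simp
  then show ?thesis using l(2)[of n] False by (simp add: field_simps)
qed

lemma approx:
  assumes "A \<in> sets M" "0 < e"
  shows "\<exists>n U. \<forall>N\<in>{M, M'}. measure N (sym_diff A (cset k n U)) < e"
proof (rule cset_approx)
  show "finite_measure N" if "N \<in> {M, M'}" for N
    using that finite_measure_axioms M'.finite_measure_axioms by blast
  show "sets N = sets (shift_space k)" if "N \<in> {M, M'}" for N
    using that sets_M M'.sets_M by blast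
qed (use assms sets_M in auto)

text \<open>If \<open>M'\<close> gave mass \<open>p > 0\<close> to an \<open>M\<close>-null set,
  some cylinder set would have \<open>M\<close>-mass at most \<open>b\<close> and
  \<open>M'\<close>-mass at least \<open>p / 2\<close>. By \<open>ent_tilted\<close> and the bound
  on \<open>rel_ent\<close> this gives \<open>p / 2 * ln (1 / b) \<le> C + ln 2\<close>, which fails
  for small \<open>b\<close>.\<close>

lemma abs_continuous:
  assumes eq: "ks_entropy M' shift + (\<integral>x. lw.ulim x \<partial>M') = 0"
    and A: "A \<in> sets M" and null: "measure M A = 0"
  shows "measure M' A = 0"
proof (rule ccontr)
  let ?p = "measure M' A"
  assume "?p \<noteq> 0"
  then have p: "0 < ?p" using measure_nonneg[of M' A] by linarith
  have A': "A \<in> sets M'" using A sets_M M'.sets_M by simp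
  \<comment> \<open>With \<open>b = exp (- t)\<close>, the first summand breaks the bound
    \<open>C + ln 2\<close>; the second makes \<open>b \<le> ?p / 2\<close>, so that the
    approximation error leaves half of the mass.\<close>
  define t where "t = 2 * (C + ln 2 + 1) / ?p + \<bar>ln (?p / 2)\<bar>"
  define b where "b = exp (- t)"
  have t: "C + ln 2 + 1 \<le> ?p / 2 * t"
  proof -
    have "?p / 2 * t = (C + ln 2 + 1) + ?p / 2 * \<bar>ln (?p / 2)\<bar>" using p by (simp add: t_def field_simps)
    moreover have "0 \<le> ?p / 2 * \<bar>ln (?p / 2)\<bar>" using p by simp
    ultimately show ?thesis by linarith
  qed
  have t0: "0 \<le> t" using C_nonneg p by (auto simp: t_def intro!: add_nonneg_nonneg divide_nonneg_nonneg)
  have b: "0 < b" by (simp add: b_def)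
  have bp: "b \<le> ?p / 2"
  proof -
    have "0 \<le> 2 * (C + ln 2 + 1) / ?p" using C_nonneg p by (auto intro!: divide_nonneg_nonneg add_nonneg_nonneg)
    then have "- t \<le> ln (?p / 2)" by (simp add: t_def)
    then have "b \<le> exp (ln (?p / 2))" unfolding b_def by (simp only: exp_le_cancel_iff)
    then show ?thesis using p by simp
  qed
  obtain n U where U: "\<forall>N\<in>{M, M'}. measure N (sym_diff A (cset k n U)) < b"
    using approx[OF A b] by blast
  let ?G = "cset k n U"
  have "measure M ?G \<le> measure M (A \<union> sym_diff A ?G)"
    using A by (intro finite_measure_mono) auto
  also have "\<dots> \<le> measure M A + measure M (sym_diff A ?G)" using A by (intro measure_Un_le) auto
  also have "\<dots> \<le> b" using U null by simp
  finally have G: "measure M ?G \<le> b" .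
  have "?p \<le> measure M' (?G \<union> sym_diff A ?G)"
    using A' by (intro M'.finite_measure_mono) auto
  also have "\<dots> \<le> measure M' ?G + measure M' (sym_diff A ?G)" using A' by (intro measure_Un_le) auto
  also have "\<dots> \<le> measure M' ?G + b" using U by simp
  finally have "?p / 2 \<le> measure M' ?G" using bp by simp
  then have "?p / 2 * t \<le> measure M' ?G * t" using t0 by (rule mult_right_mono)
  also have "\<dots> \<le> C + ln 2" using ent_tilted[OF G b] rel_ent_bounded[OF eq, of n] by (simp add: b_def)
  finally show False using t by simp
qed

text \<open>The upper frequency of visits to the cylinder of \<open>w\<close> is invariant, hence
  constant \<open>M\<close>-almost everywhere by ergodicity, and its integral identifies the
  constant as \<open>wm M w\<close>. Absolute continuity carries this over to \<open>M'\<close>,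
  where the integral is \<open>wm M' w\<close>.\<close>

lemma wm_eq_of_zero:
  assumes eq: "ks_entropy M' shift + (\<integral>x. lw.ulim x \<partial>M') = 0" and w: "w \<in> words k n"
  shows "wm M' w = wm M w"
proof -
  let ?I = "cset k n {w}"
  define s where "s j x = (\<Sum>i<j. indicator ?I ((shift ^^ i) x) :: real)" for j x
  have cocycle: "almost_additive_cocycle N shift s 0 1" if "shift_inv k N" for N
  proof -
    interpret N: shift_inv k N by fact
    show ?thesis
    proof unfold_locales
      show "s j \<in> borel_measurable N" for j
        unfolding s_def using measurable_compose[OF N.funpow_measurable, of "indicator ?I" borel]
        by (intro borel_measurable_sum) auto
      have split: "s (i + j) x = s i x + s j ((shift ^^ i) x)" for i j x
        by (induction j) (auto simp: s_def funpow_add add.commute)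
      show "\<bar>s (i + j) x - s i x - s j ((shift ^^ i) x)\<bar> \<le> 0" for i j x
        by (simp add: split)
      show "\<bar>s j x\<bar> \<le> 1 * real j" for j x
      proof -
        have "0 \<le> s j x" unfolding s_def by (intro sum_nonneg) auto
        moreover have "s j x \<le> (\<Sum>i<j. 1)" unfolding s_def by (intro sum_mono) (auto simp: indicator_def)
        ultimately show ?thesis by simp
      qed
    qed
  qed
  \<comment> \<open>No measure enters this definition, so the integrated ergodic theorem for
    \<open>M\<close> and for \<open>M'\<close> speaks of the same function.\<close>
  define u where "u x = limavg (\<lambda>j. s j x)" for x
  have int_u: "(\<integral>x. u x \<partial>N) = wm N w" if "shift_inv k N" for N
  proof -
    interpret N: shift_inv k N by fact
    interpret N: almost_additive_cocycle N shift s 0 1 by (rule cocycle) fact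
    have "(\<integral>x. s j x \<partial>N) = real j * wm N w" for j
    proof -
      have m: "(indicator ?I :: _ \<Rightarrow> real) \<in> borel_measurable N" by simp
      have i: "integrable N (\<lambda>x. indicator ?I ((shift ^^ i) x) :: real)" for i
        using measurable_compose[OF N.funpow_measurable m]
        by (intro N.integrable_bounded[of _ 1]) (auto simp: indicator_def)
      have "(\<integral>x. s j x \<partial>N) = (\<Sum>i<j. \<integral>x. indicator ?I ((shift ^^ i) x) \<partial>N)"
        unfolding s_def by (rule Bochner_Integration.integral_sum) (rule i)
      also have "\<dots> = (\<Sum>i<j. measure N ?I)"
        using N.integral_funpow[OF m] sets.sets_into_space[OF N.cset_sets, of n "{w}"]
        by (simp add: Int_absorb2)
      finally show ?thesis using N.wm_eq[OF w] by simp
    qed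
    then have "\<forall>\<^sub>F j in sequentially. (\<integral>x. s j x \<partial>N) / real j = wm N w"
      by (intro eventually_sequentiallyI[of 1]) simp
    then have "(\<lambda>j. (\<integral>x. s j x \<partial>N) / real j) \<longlonglongrightarrow> wm N w" by (rule tendsto_eventually)
    then show ?thesis using LIMSEQ_unique[OF N.integral_ulim] by (simp add: u_def N.ulim_def)
  qed
  interpret s: almost_additive_cocycle M shift s 0 1 by (rule cocycle) (rule shift_inv_axioms)
  have u: "s.ulim = u" by (rule ext) (simp add: s.ulim_def u_def)
  let ?c = "wm M w"
  have um: "u \<in> borel_measurable M" using s.ulim_measurable unfolding u .
  then have m: "{x \<in> space M. u x < ?c} \<in> sets M" "{x \<in> space M. ?c < u x} \<in> sets M"
    by measurable
  \<comment> \<open>Were \<open>u\<close> almost everywhere strictly on one side of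
    \<open>?c\<close>, its integral could not be \<open>?c\<close>; so the invariant set has mass 0
    rather than 1.\<close>
  have null: "measure M {x \<in> space M. R (u x) ?c} = 0"
    if R: "R = (<) \<or> R = (>)" for R :: "real \<Rightarrow> real \<Rightarrow> bool"
  proof -
    let ?E = "{x \<in> space M. R (u x) ?c}"
    have E: "?E \<in> sets M" using R m by (auto simp del: space_M)
    have "shift x \<in> ?E \<longleftrightarrow> x \<in> ?E" if "x \<in> fullshift k" for x
      using s.ulim_T[of x] that shift_fullshift[of x k] unfolding u by auto
    then have "measure M ?E = 0 \<or> measure M ?E = 1" by (rule ergodic[OF E])
    moreover have "measure M ?E \<noteq> 1"
    proof
      assume "measure M ?E = 1"
      then have AE: "AE x in M. R (u x) ?c"
        using prob_eq_1[OF E] by (auto elim: eventually_mono)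
      have c: "(\<integral>x. u x \<partial>M) = ?c" using int_u[OF shift_inv_axioms] .
      have iu: "integrable M u" using s.integrable_ulim unfolding u .
      show False
      proof (cases "R = (<)")
        case True
        then have "(\<integral>x. u x \<partial>M) < (\<integral>x. ?c \<partial>M)"
          using AE iu by (intro integral_less_AE_space) (auto simp: emeasure_space_1 simp del: space_M)
        then show False using c prob_space by simp
      next
        case False
        then have "(\<integral>x. ?c \<partial>M) < (\<integral>x. u x \<partial>M)"
          using AE iu R by (intro integral_less_AE_space) (auto simp: emeasure_space_1 simp del: space_M)
        then show False using c prob_space by simp
      qed
    qed
    ultimately show ?thesis by blast
  qed
  have "AE x in M'. u x = ?c"
  proof -
    have "measure M' {x \<in> space M. u x < ?c} = 0" "measure M' {x \<in> space M. ?c < u x} = 0"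
      using abs_continuous[OF eq m(1)] abs_continuous[OF eq m(2)] null[of "(<)"] null[of "(>)"] by auto
    then have "{x \<in> space M. u x < ?c} \<in> null_sets M'" "{x \<in> space M. ?c < u x} \<in> null_sets M'"
      using m sets_M M'.sets_M by (auto simp: null_sets_def M'.emeasure_eq_measure)
    then have "AE x in M'. x \<notin> {x \<in> space M. u x < ?c}" "AE x in M'. x \<notin> {x \<in> space M. ?c < u x}"
      by - (rule AE_not_in, assumption)+
    with AE_space show ?thesis by eventually_elim auto
  qed
  then have "(\<integral>x. u x \<partial>M') = (\<integral>x. ?c \<partial>M')"
    using um measurable_cong_sets[of M' M borel borel] sets_M M'.sets_M
    by (intro integral_cong_AE) auto
  then show ?thesis using int_u[OF M'.shift_inv_axioms] M'.prob_space by simp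
qed

text \<open>Equal word masses give equal masses of cylinder sets, and simultaneous approximation
  extends this to Borel sets.\<close>

lemma eq_of_zero:
  assumes eq: "ks_entropy M' shift + (\<integral>x. lw.ulim x \<partial>M') = 0"
  shows "M' = M"
proof (rule measure_eqI)
  show "sets M' = sets M" using sets_M M'.sets_M by simp
  fix A assume A: "A \<in> sets M'"
  have A': "A \<in> sets M" using A sets_M M'.sets_M by simp
  have cs: "measure M' (cset k n U) = measure M (cset k n U)" for n U
    unfolding measure_cset M'.measure_cset by (intro sum.cong refl wm_eq_of_zero[OF eq, of _ n]) auto
  have "\<bar>measure M' A - measure M A\<bar> \<le> 0 + e" if e: "0 < e" for e
  proof -
    obtain n U where U: "\<forall>N\<in>{M, M'}. measure N (sym_diff A (cset k n U)) < e / 2"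
      using approx[OF A', of "e / 2"] e by auto
    let ?G = "cset k n U"
    have "\<bar>measure N A - measure N ?G\<bar> < e / 2" if N: "N \<in> {M, M'}" for N
    proof -
      have fN: "finite_measure N" using N finite_measure_axioms M'.finite_measure_axioms by auto
      have s: "A \<in> sets N" "?G \<in> sets N" using N A A' by auto
      then have d: "sym_diff A ?G \<in> sets N" by auto
      have "measure N A \<le> measure N (?G \<union> sym_diff A ?G)"
        using s d by (intro finite_measure.finite_measure_mono[OF fN]) auto
      moreover have "measure N ?G \<le> measure N (A \<union> sym_diff A ?G)"
        using s d by (intro finite_measure.finite_measure_mono[OF fN]) auto
      moreover have "measure N (sym_diff A ?G) < e / 2" using U N by blast
      ultimately show ?thesis using measure_Un_le[OF s(1) d] measure_Un_le[OF s(2) d] by linarith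
    qed
    then have "\<bar>measure M A - measure M ?G\<bar> < e / 2" "\<bar>measure M' A - measure M' ?G\<bar> < e / 2" by blast+
    then show ?thesis using cs[of n U] by linarith
  qed
  then have "\<bar>measure M' A - measure M A\<bar> \<le> 0" by (rule field_le_epsilon)
  then show "emeasure M' A = emeasure M A"
    by (simp add: emeasure_eq_measure M'.emeasure_eq_measure)
qed

end

text \<open>Free of the locale for pairs of measures, so that it can be used for \<mu> on
  \<open>X\<close> as well as for its image on \<open>Y\<close>.\<close>

lemma (in quasi_bernoulli) variational:
  assumes M': "M' \<in> inv_measures k"
  defines "l \<equiv> \<integral>x. limavg (\<lambda>n. lw n x) \<partial>M'"
  shows "(\<lambda>n. (\<integral>x. lw n x \<partial>M') / real n) \<longlonglongrightarrow> l"
    and "ks_entropy M' shift + l \<le> 0"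
    and "ks_entropy M' shift + l = 0 \<longleftrightarrow> M' = M"
proof -
  interpret relative_to_qb k M C M'
    by unfold_locales (rule M')
  have l: "l = (\<integral>x. lw.ulim x \<partial>M')" by (simp add: l_def lw.ulim_def)
  show "(\<lambda>n. (\<integral>x. lw n x \<partial>M') / real n) \<longlonglongrightarrow> l" unfolding l by (rule lw.integral_ulim)
  show "ks_entropy M' shift + l \<le> 0" unfolding l by (rule free_energy_le)
  show "ks_entropy M' shift + l = 0 \<longleftrightarrow> M' = M"
  proof
    assume "ks_entropy M' shift + l = 0"
    then show "M' = M" unfolding l by (rule eq_of_zero)
  next
    assume eq: "M' = M"
    \<comment> \<open>For \<open>M\<close> against itself, \<open>- lw n\<close> is exactly the
      information function of the prefix.\<close>
    have "rel_ent n = 0" for n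
    proof -
      have "rel_ent n = - ent M' (pre n) - (\<integral>x. lw n x \<partial>M')" by (rule rel_ent_def)
      also have "\<dots> = 0" unfolding eq by (simp add: ent_def lw_def wm_pre)
      finally show ?thesis .
    qed
    then show "ks_entropy M' shift + l = 0"
      unfolding l using LIMSEQ_unique[OF free_energy_limit, of 0] by simp
  qed
qed

section \<open>Gibbs measures, factor maps and relative pressure\<close>

lemma (in shift_inv) measure_cyl: "measure M (cyl k x n) = wm M (pre n x)"
proof -
  have "cyl k x n = {z \<in> space M. pre n z = pre n x}"
    by (auto simp: cyl_def itin_eq_iff shift_funpow)
  then show ?thesis by (simp add: wm_pre fib_def)
qed

text \<open>From here on \<open>f\<close> is known only through continuity, positivity and its
  comparison with cylinder masses.\<close>

locale gibbs_system =
  fixes k :: nat and f :: "nat \<Rightarrow> (nat \<Rightarrow> nat) \<Rightarrow> real" and \<mu> :: "(nat \<Rightarrow> nat) measure" and P C K :: real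
  assumes cont: "n \<ge> 1 \<Longrightarrow> continuous_on (fullshift k) (f n)"
    and f_pos: "n \<ge> 1 \<Longrightarrow> x \<in> fullshift k \<Longrightarrow> 0 < f n x"
    and qb: "quasi_bernoulli k \<mu> C"
    and compare: "n \<ge> 1 \<Longrightarrow> x \<in> fullshift k \<Longrightarrow> \<bar>ln (f n x) - real n * P - ln (wm \<mu> (pre n x))\<bar> \<le> K"
begin

sublocale quasi_bernoulli k \<mu> C
  rewrites "quasi_bernoulli.lw \<mu> = (\<lambda>n x. ln (wm \<mu> (pre n x)))"
  by (fact qb) (simp add: fun_eq_iff quasi_bernoulli.lw_def[OF qb])

end

text \<open>In logarithms the Gibbs property exchanges \<open>f n\<close> for the cylinder mass up
  to \<open>K = ln C0\<close>; the pressure terms cancel because they are additive in the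
  length.\<close>

lemma gibbs_system_of_gibbs:
  assumes k: "1 \<le> k" and aa: "almost_additive k f" and inv: "\<mu> \<in> inv_measures k" and g: "gibbs k f \<mu>"
  obtains C K where "gibbs_system k f \<mu> (top_pressure k f) C K"
proof -
  interpret shift_inv k \<mu> by unfold_locales (rule inv)
  let ?P = "top_pressure k f"
  have f_pos: "0 < f n x" if "n \<ge> 1" "x \<in> fullshift k" for n x
    using aa that by (auto simp: almost_additive_def)
  obtain C0 where C0: "0 < C0" "\<And>x n. x \<in> fullshift k \<Longrightarrow> n \<ge> 1 \<Longrightarrow>
      inverse C0 < measure \<mu> (cyl k x n) / (exp (- real n * ?P) * f n x) \<and>
      measure \<mu> (cyl k x n) / (exp (- real n * ?P) * f n x) < C0"
    using g unfolding gibbs_def by blast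
  define K where "K = ln C0"
  have pre: "0 < wm \<mu> (pre n x) \<and> \<bar>ln (f n x) - real n * ?P - ln (wm \<mu> (pre n x))\<bar> \<le> K"
    if n: "n \<ge> 1" and x: "x \<in> fullshift k" for n x
  proof -
    define e where "e = exp (- real n * ?P)"
    define r where "r = wm \<mu> (pre n x) / (e * f n x)"
    have f: "0 < f n x" and e: "0 < e" using f_pos[OF n x] by (auto simp: e_def)
    have r: "inverse C0 < r" "r < C0" using C0(2)[OF x n] by (simp_all add: r_def e_def measure_cyl)
    have r0: "0 < r" using r(1) C0(1) by (meson inverse_positive_iff_positive order_less_trans)
    have "wm \<mu> (pre n x) = r * (e * f n x)" using e f by (simp add: r_def)
    then have w: "0 < wm \<mu> (pre n x)" using r0 e f by simp
    have "ln r = ln (wm \<mu> (pre n x)) - (ln e + ln (f n x))"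
      unfolding r_def using w e f by (simp add: ln_div ln_mult)
    moreover have "ln e = - real n * ?P" by (simp add: e_def)
    moreover have "ln r \<le> ln C0" using r(2) r0 C0(1) by simp
    moreover have "- ln C0 \<le> ln r"
    proof -
      have "ln (inverse C0) \<le> ln r" using r(1) r0 C0(1) by (subst ln_le_cancel_iff) auto
      then show ?thesis using C0(1) by (simp add: ln_inverse)
    qed
    ultimately show ?thesis using w by (auto simp: K_def)
  qed
  obtain C where C: "0 < C" "\<And>n m x. n \<ge> 1 \<Longrightarrow> m \<ge> 1 \<Longrightarrow> x \<in> fullshift k \<Longrightarrow>
      exp (- C) * f n x * f m ((shift ^^ n) x) \<le> f (n + m) x \<and>
      f (n + m) x \<le> exp C * f n x * f m ((shift ^^ n) x)"
    using aa unfolding almost_additive_def by blast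
  have K: "0 \<le> K"
  proof -
    have "pad [] \<in> fullshift k" using k by (intro pad_fullshift) auto
    from pre[OF order_refl this] show ?thesis by linarith
  qed
  have pos: "0 < wm \<mu> w" if "set w \<subseteq> {..<k}" for w
  proof (cases "w = []")
    case False
    then show ?thesis using pre[of "length w" "pad w"] pad_fullshift[OF k that] by (simp add: pre_pad Suc_le_eq)
  qed (simp add: wm_Nil)
  \<comment> \<open>\<open>C\<close> comes from almost additivity, and one \<open>K\<close> from
    each of the three exchanges. Empty words are treated apart because almost additivity starts at
    length 1.\<close>
  have prod: "\<bar>ln (wm \<mu> (u @ v)) - ln (wm \<mu> u) - ln (wm \<mu> v)\<bar> \<le> C + 3 * K"
    if u: "set u \<subseteq> {..<k}" and v: "set v \<subseteq> {..<k}" for u v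
  proof (cases "u = [] \<or> v = []")
    case True
    then show ?thesis using C(1) K by (auto simp: wm_Nil)
  next
    case False
    let ?n = "length u" and ?m = "length v"
    let ?x = "pad (u @ v)"
    let ?y = "(shift ^^ ?n) ?x"
    have n: "?n \<ge> 1" "?m \<ge> 1" using False by (auto simp: Suc_le_eq)
    have x: "?x \<in> fullshift k" using u v k by (intro pad_fullshift) auto
    have y: "?y \<in> fullshift k" using funpow_space[of ?x] x by simp
    have w: "pre (?n + ?m) ?x = u @ v" using pre_pad[of "u @ v"] by simp
    then have uv: "pre ?n ?x = u" "pre ?m ?y = v" by (simp_all add: itin_add)
    have fp: "0 < f ?n ?x" "0 < f ?m ?y" "0 < f (?n + ?m) ?x"
      using f_pos[OF n(1) x] f_pos[OF n(2) y] f_pos[of "?n + ?m", OF _ x] n by auto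
    have "ln (exp (- C) * f ?n ?x * f ?m ?y) \<le> ln (f (?n + ?m) ?x)"
      using C(2)[OF n x] fp by (subst ln_le_cancel_iff) auto
    moreover have "ln (f (?n + ?m) ?x) \<le> ln (exp C * f ?n ?x * f ?m ?y)"
      using C(2)[OF n x] fp by (subst ln_le_cancel_iff) auto
    ultimately have "\<bar>ln (f (?n + ?m) ?x) - ln (f ?n ?x) - ln (f ?m ?y)\<bar> \<le> C"
      using fp by (simp add: ln_mult)
    moreover have "\<bar>ln (f (?n + ?m) ?x) - real (?n + ?m) * ?P - ln (wm \<mu> (u @ v))\<bar> \<le> K"
      using pre[of "?n + ?m", OF _ x] n w by simp
    moreover have "\<bar>ln (f ?n ?x) - real ?n * ?P - ln (wm \<mu> u)\<bar> \<le> K" using pre[OF n(1) x] uv by simp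
    moreover have "\<bar>ln (f ?m ?y) - real ?m * ?P - ln (wm \<mu> v)\<bar> \<le> K" using pre[OF n(2) y] uv by simp
    moreover have "real (?n + ?m) * ?P = real ?n * ?P + real ?m * ?P" by (simp add: algebra_simps)
    ultimately show ?thesis by linarith
  qed
  have "quasi_bernoulli k \<mu> (C + 3 * K)"
  proof unfold_locales
    fix u v assume u: "set u \<subseteq> {..<k}" and v: "set v \<subseteq> {..<k}"
    have p: "0 < wm \<mu> u" "0 < wm \<mu> v" "0 < wm \<mu> (u @ v)" using pos u v by auto
    have "exp (- (C + 3 * K) + (ln (wm \<mu> u) + ln (wm \<mu> v))) \<le> exp (ln (wm \<mu> (u @ v)))"
      "exp (ln (wm \<mu> (u @ v))) \<le> exp ((C + 3 * K) + (ln (wm \<mu> u) + ln (wm \<mu> v)))"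
      using prod[OF u v] by (auto simp only: exp_le_cancel_iff)
    then show "exp (- (C + 3 * K)) * (wm \<mu> u * wm \<mu> v) \<le> wm \<mu> (u @ v)"
      "wm \<mu> (u @ v) \<le> exp (C + 3 * K) * (wm \<mu> u * wm \<mu> v)"
      using p by (simp_all only: exp_add exp_ln)
  qed (rule pos)
  moreover have "continuous_on (fullshift k) (f n)" if "n \<ge> 1" for n
    using aa that by (auto simp: almost_additive_def)
  ultimately have "gibbs_system k f \<mu> ?P (C + 3 * K) K"
    using pre f_pos by (intro gibbs_system.intro) auto
  then show thesis by (rule that)
qed

section \<open>The image measure and the relative pressure\<close>

text \<open>Here \<open>p\<close> is the letter map behind \<pi>, and \<open>q\<close> picks a
  letter above each letter of \<open>Y\<close>; it supplies lifts of words and continuations inside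
  a fibre.\<close>

locale gibbs_factor = gibbs_system +
  fixes l :: nat and \<pi> :: "(nat \<Rightarrow> nat) \<Rightarrow> (nat \<Rightarrow> nat)" and p q :: "nat \<Rightarrow> nat"
  assumes fac: "one_block_factor k l \<pi>"
    and \<pi>: "x \<in> fullshift k \<Longrightarrow> \<pi> x = (\<lambda>i. p (x i))"
    and q_lift: "b < l \<Longrightarrow> q b < k \<and> p (q b) = b"
begin

abbreviation "\<nu> \<equiv> push l \<pi> \<mu>"

lemma \<pi>_fullshift: "x \<in> fullshift k \<Longrightarrow> \<pi> x \<in> fullshift l"
  using fac by (auto simp: one_block_factor_def)

lemma \<pi>_measurable: "\<pi> \<in> \<mu> \<rightarrow>\<^sub>M shift_space l"
proof -
  have "\<pi> \<in> shift_space k \<rightarrow>\<^sub>M shift_space l"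
    unfolding shift_space_def
  proof (rule measurable_restrict_space2)
    show "\<pi> \<in> borel_measurable (restrict_space borel (fullshift k))"
      using fac by (intro borel_measurable_continuous_on_restrict) (simp add: one_block_factor_def)
  qed (use \<pi>_fullshift in \<open>auto simp: space_restrict_space\<close>)
  then show ?thesis using measurable_cong_sets[OF sets_M refl] by blast
qed

lemma pre_\<pi>: "x \<in> fullshift k \<Longrightarrow> pre n (\<pi> x) = map p (pre n x)"
  by (simp add: pre_eq \<pi>)

lemma push_inv: "\<nu> \<in> inv_measures l"
  unfolding inv_measures_def
proof (intro CollectI conjI ballI)
  show "prob_space \<nu>" unfolding push_def by (rule prob_space_distr[OF \<pi>_measurable])
  show "sets \<nu> = sets (shift_space l)" by (simp add: push_def)
  fix A assume "A \<in> sets \<nu>"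
  then have A: "A \<in> sets (shift_space l)" by (simp add: push_def)
  have B: "\<pi> -` A \<inter> space \<mu> \<in> sets \<mu>" by (rule measurable_sets[OF \<pi>_measurable A])
  have S: "shift -` A \<inter> fullshift l \<in> sets (shift_space l)"
    using measurable_sets[OF shift_measurable A] by simp
  have "emeasure \<nu> (shift -` A \<inter> space \<nu>) = emeasure \<mu> (\<pi> -` (shift -` A \<inter> fullshift l) \<inter> space \<mu>)"
    using emeasure_distr[OF \<pi>_measurable S] by (simp add: push_def)
  also have "\<pi> -` (shift -` A \<inter> fullshift l) \<inter> space \<mu> = shift -` (\<pi> -` A \<inter> space \<mu>) \<inter> space \<mu>"
    using fac shift_fullshift \<pi>_fullshift by (auto simp: one_block_factor_def)
  also have "emeasure \<mu> \<dots> = emeasure \<mu> (\<pi> -` A \<inter> space \<mu>)"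
    using inv B unfolding inv_measures_def by blast
  also have "\<dots> = emeasure \<nu> A" using emeasure_distr[OF \<pi>_measurable A] by (simp add: push_def)
  finally show "emeasure \<nu> (shift -` A \<inter> space \<nu>) = emeasure \<nu> A" .
qed

sublocale \<nu>: shift_inv l \<nu>
  by unfold_locales (rule push_inv)

lemma wm_push:
  assumes v: "v \<in> words l n"
  shows "wm \<nu> v = measure \<mu> (cset k n {u. map p u = v})"
proof -
  have "wm \<nu> v = measure \<nu> (cset l n {v})" by (rule \<nu>.wm_eq[OF v])
  also have "\<dots> = measure \<mu> (\<pi> -` cset l n {v} \<inter> space \<mu>)"
    unfolding push_def by (rule measure_distr[OF \<pi>_measurable cset_measurable])
  also have "\<pi> -` cset l n {v} \<inter> space \<mu> = cset k n {u. map p u = v}"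
    by (auto simp: cset_def pre_\<pi> \<pi>_fullshift)
  finally show ?thesis .
qed

text \<open>The mass of a word is the \<mu>-mass of the set of its lifts, so mixing for sets of
  words passes on with the same constant; the lift \<open>map q v\<close> gives positivity.\<close>

lemma push_qb: "quasi_bernoulli l \<nu> C"
proof unfold_locales
  fix v assume v: "set v \<subseteq> {..<l}"
  then have vw: "v \<in> words l (length v)" by (simp add: words_def)
  have u: "map q v \<in> words k (length v) \<inter> {u. map p u = v}"
    using v q_lift by (auto simp: words_def subset_iff map_idI)
  have "0 < wm \<mu> (map q v)" using u by (intro pos) (auto simp: words_def)
  also have "\<dots> \<le> (\<Sum>w\<in>words k (length v) \<inter> {u. map p u = v}. wm \<mu> w)"
    using u finite_words by (intro member_le_sum) (auto simp: wm_def fib_nonneg)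
  finally show "0 < wm \<nu> v" by (simp add: wm_push[OF vw] measure_cset)
next
  fix v v' assume v: "set v \<subseteq> {..<l}" "set v' \<subseteq> {..<l}"
  let ?n = "length v" and ?m = "length v'"
  have vw: "v \<in> words l ?n" "v' \<in> words l ?m" using v by (simp_all add: words_def)
  have "cset k (?n + ?m) {w. map p w = v @ v'}
      = cset k (?n + ?m) {w. take ?n w \<in> {u. map p u = v} \<and> drop ?n w \<in> {u. map p u = v'}}"
    by (auto simp: cset_def append_eq_conv_conj take_map drop_map itin_add)
  then have e: "wm \<nu> (v @ v')
      = measure \<mu> (cset k (?n + ?m) {w. take ?n w \<in> {u. map p u = v} \<and> drop ?n w \<in> {u. map p u = v'}})"
    using wm_push[OF words_append[OF vw]] by simp
  show "exp (- C) * (wm \<nu> v * wm \<nu> v') \<le> wm \<nu> (v @ v')"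
    unfolding e wm_push[OF vw(1)] wm_push[OF vw(2)] by (rule mixing(1))
  show "wm \<nu> (v @ v') \<le> exp C * (wm \<nu> v * wm \<nu> v')"
    unfolding e wm_push[OF vw(1)] wm_push[OF vw(2)] by (rule mixing(2))
qed

sublocale \<nu>: quasi_bernoulli l \<nu> C
  rewrites "quasi_bernoulli.lw \<nu> = (\<lambda>n x. ln (wm \<nu> (pre n x)))"
  by (fact push_qb) (simp add: fun_eq_iff quasi_bernoulli.lw_def[OF push_qb])

definition sep_sums :: "(nat \<Rightarrow> nat) \<Rightarrow> real \<Rightarrow> nat \<Rightarrow> real set" where
  "sep_sums y \<epsilon> n = {\<Sum>x\<in>E. f n x | E. finite E \<and> E \<subseteq> fullshift k \<inter> \<pi> -` {y} \<and> separated n \<epsilon> E}"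

lemma f_le:
  assumes "n \<ge> 1" "x \<in> fullshift k"
  shows "f n x \<le> exp K * exp (real n * P) * wm \<mu> (pre n x)"
    and "exp (- K) * exp (real n * P) * wm \<mu> (pre n x) \<le> f n x"
proof -
  have w: "0 < wm \<mu> (pre n x)" by (rule pre_pos[OF assms(2)])
  have "exp (ln (f n x)) \<le> exp (K + real n * P + ln (wm \<mu> (pre n x)))"
    "exp (- K + real n * P + ln (wm \<mu> (pre n x))) \<le> exp (ln (f n x))"
    using compare[OF assms] by (auto simp only: exp_le_cancel_iff)
  then show "f n x \<le> exp K * exp (real n * P) * wm \<mu> (pre n x)"
    and "exp (- K) * exp (real n * P) * wm \<mu> (pre n x) \<le> f n x"
    using w f_pos[OF assms] by (simp_all only: exp_add exp_ln)
qed

lemma wm_push_pre: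
  assumes "y \<in> fullshift l"
  shows "wm \<nu> (pre n y) = (\<Sum>u\<in>words k n \<inter> {u. map p u = pre n y}. wm \<mu> u)"
  using wm_push[OF pre_in_words[OF assms]] measure_cset by simp

text \<open>If \<open>(1/2) ^ j \<le> \<epsilon>\<close>, separated points differ among their first
  \<open>n + j\<close> letters, so \<open>E\<close> injects into words of that length whose first
  \<open>n\<close> letters lie over the prefix of \<open>y\<close>. Passing from an
  \<open>n\<close>-prefix to its extension by \<open>j\<close> letters costs a factor that depends
  on \<open>j\<close> but not on \<open>n\<close>.\<close>

lemma sep_sums_upper:
  assumes y: "y \<in> fullshift l" and n: "n \<ge> 1" and j: "(1/2) ^ j \<le> \<epsilon>" and s: "s \<in> sep_sums y \<epsilon> n"
  shows "s \<le> exp (K + C + quasi_bernoulli.K k \<mu> C * real j) * (exp (real n * P) * wm \<nu> (pre n y))"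
proof -
  \<comment> \<open>This is the growth bound of \<open>lw\<close>, to be kept apart from the locale
    parameter \<open>K\<close>, which compares \<open>f\<close> with \<mu>.\<close>
  let ?K = "quasi_bernoulli.K k \<mu> C"
  obtain E where E: "finite E" "E \<subseteq> fullshift k" "\<And>x. x \<in> E \<Longrightarrow> \<pi> x = y" "separated n \<epsilon> E"
    and s: "s = (\<Sum>x\<in>E. f n x)" using s by (auto simp: sep_sums_def)
  have inj: "inj_on (pre (n + j)) E"
  proof (rule inj_onI, rule ccontr)
    fix x x' assume x: "x \<in> E" "x' \<in> E" "pre (n + j) x = pre (n + j) x'" "x \<noteq> x'"
    obtain i where i: "i < n" "shift_dist ((shift ^^ i) x) ((shift ^^ i) x') > \<epsilon>"
      using E(4) x unfolding separated_def by blast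
    define t where "t = (LEAST t. (shift ^^ i) x t \<noteq> (shift ^^ i) x' t)"
    have ne: "(shift ^^ i) x \<noteq> (shift ^^ i) x'"
    proof
      assume "(shift ^^ i) x = (shift ^^ i) x'"
      then have "\<epsilon> < 0" using i(2) by (simp add: shift_dist_def)
      moreover have "(0::real) < (1/2) ^ j" by simp
      ultimately show False using j by linarith
    qed
    then have "\<exists>t. (shift ^^ i) x t \<noteq> (shift ^^ i) x' t" by blast
    then have t: "(shift ^^ i) x t \<noteq> (shift ^^ i) x' t" unfolding t_def by (rule LeastI_ex)
    have "\<epsilon> < (1/2) ^ t" using i(2) ne by (simp add: shift_dist_def t_def)
    then have "(1/2::real) ^ j < (1/2) ^ t" using j by linarith
    then have "t < j" by (subst (asm) power_strict_decreasing_iff) auto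
    moreover have "x (i + t') = x' (i + t')" if "i + t' < n + j" for t'
      using x(3) that by (auto simp: itin_eq_iff shift_funpow)
    ultimately show False using t i(1) by (auto simp: shift_funpow)
  qed
  have bound: "f n x \<le> exp (K + C + ?K * real j) * exp (real n * P) * wm \<mu> (pre (n + j) x)" if x: "x \<in> E" for x
  proof -
    have x': "x \<in> fullshift k" using x E by auto
    have y': "(shift ^^ n) x \<in> fullshift k" using funpow_space[of x n] x' by simp
    have "ln (wm \<mu> (pre n x)) \<le> ln (wm \<mu> (pre (n + j) x)) + C + ?K * real j"
      using lw_add[OF x', of n j] lw_bound[OF y', of j] by linarith
    then have "exp (ln (wm \<mu> (pre n x))) \<le> exp (C + ?K * real j + ln (wm \<mu> (pre (n + j) x)))"
      by (simp only: exp_le_cancel_iff)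
    then have "wm \<mu> (pre n x) \<le> exp (C + ?K * real j) * wm \<mu> (pre (n + j) x)"
      using pre_pos[OF x'] by (simp only: exp_add[of "C + ?K * real j"] exp_ln)
    then have "exp K * exp (real n * P) * wm \<mu> (pre n x)
        \<le> exp K * exp (real n * P) * (exp (C + ?K * real j) * wm \<mu> (pre (n + j) x))"
      by (intro mult_left_mono) auto
    also have "\<dots> = exp (K + C + ?K * real j) * exp (real n * P) * wm \<mu> (pre (n + j) x)"
      by (simp add: exp_add)
    finally show ?thesis using f_le(1)[OF n x'] by linarith
  qed
  have "s \<le> (\<Sum>x\<in>E. exp (K + C + ?K * real j) * exp (real n * P) * wm \<mu> (pre (n + j) x))"
    unfolding s by (rule sum_mono) (rule bound)
  also have "\<dots> = exp (K + C + ?K * real j) * exp (real n * P) * (\<Sum>w\<in>pre (n + j) ` E. wm \<mu> w)"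
    by (simp add: sum.reindex[OF inj] sum_distrib_left)
  also have "(\<Sum>w\<in>pre (n + j) ` E. wm \<mu> w) \<le> (\<Sum>w\<in>words k (n + j) \<inter> {w. take n w \<in> {u. map p u = pre n y}}. wm \<mu> w)"
  proof (rule sum_mono2)
    have take_pre: "take n (pre (n + j) x) = pre n x" for x by (simp add: itin_add)
    have "map p (pre n x) = pre n y" if "x \<in> E" for x
      using that E(2) E(3)[OF that] pre_\<pi>[of x n] by auto
    then show "pre (n + j) ` E \<subseteq> words k (n + j) \<inter> {w. take n w \<in> {u. map p u = pre n y}}"
      using E(2) pre_in_words by (auto simp: take_pre)
  qed (auto simp: finite_words wm_def fib_nonneg)
  also have "\<dots> = wm \<nu> (pre n y)"
    unfolding wm_push[OF pre_in_words[OF y]] cset_mono_length[of n "n + j" k, OF le_add1] measure_cset ..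
  finally show ?thesis by (simp add: mult.assoc)
qed

text \<open>Each word over the prefix of \<open>y\<close> is continued inside the fibre by the
  letters \<open>q (y i)\<close>. Distinct words differ at some time \<open>i < n\<close>, when the
  shifted points are at distance 1, which exceeds \<open>\<epsilon>\<close>.\<close>

lemma sep_sums_lower:
  assumes y: "y \<in> fullshift l" and n: "n \<ge> 1" and \<epsilon>: "\<epsilon> < 1"
  shows "\<exists>s\<in>sep_sums y \<epsilon> n. exp (- K) * (exp (real n * P) * wm \<nu> (pre n y)) \<le> s"
proof -
  let ?U = "words k n \<inter> {u. map p u = pre n y}"
  define g where "g u i = (if i < n then u ! i else q (y i))" for u i
  have y': "y i < l" for i using y by (simp add: fullshift_def)
  have g: "g u \<in> fullshift k" "\<pi> (g u) = y" "pre n (g u) = u" if u: "u \<in> ?U" for u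
  proof -
    have len: "length u = n" using u by (simp add: words_def)
    show gk: "g u \<in> fullshift k"
      using u q_lift[OF y'] by (auto simp: g_def fullshift_def words_def subset_iff)
    show "pre n (g u) = u" using len by (simp add: pre_eq_iff g_def)
    have "p (g u i) = y i" for i
    proof (cases "i < n")
      case True
      have "map p u ! i = pre n y ! i" using u by simp
      then show ?thesis using True len by (simp add: g_def nth_itin shift_funpow)
    qed (simp add: g_def q_lift[OF y'])
    then show "\<pi> (g u) = y" using \<pi>[OF gk] by simp
  qed
  have inj: "inj_on g ?U" by (rule inj_on_inverseI[where g = "pre n"]) (rule g(3))
  have "separated n \<epsilon> (g ` ?U)"
    unfolding separated_def
  proof (intro ballI impI)
    fix x x' assume x: "x \<in> g ` ?U" "x' \<in> g ` ?U" "x \<noteq> x'"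
    then have "pre n x \<noteq> pre n x'" using g(3) by auto
    then obtain i where i: "i < n" "x i \<noteq> x' i" by (auto simp: itin_eq_iff shift_funpow)
    then have "(shift ^^ i) x 0 \<noteq> (shift ^^ i) x' 0" by (simp add: shift_funpow)
    then have "shift_dist ((shift ^^ i) x) ((shift ^^ i) x') = 1"
      by (auto simp: shift_dist_def Least_eq_0)
    then show "\<exists>i<n. shift_dist ((shift ^^ i) x) ((shift ^^ i) x') > \<epsilon>" using i(1) \<epsilon> by auto
  qed
  then have "(\<Sum>x\<in>g ` ?U. f n x) \<in> sep_sums y \<epsilon> n"
    unfolding sep_sums_def using finite_words g(1,2) by (intro CollectI exI[of _ "g ` ?U"]) auto
  moreover have "exp (- K) * (exp (real n * P) * wm \<nu> (pre n y)) \<le> (\<Sum>x\<in>g ` ?U. f n x)"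
  proof -
    have "exp (- K) * (exp (real n * P) * wm \<nu> (pre n y)) = (\<Sum>u\<in>?U. exp (- K) * exp (real n * P) * wm \<mu> (pre n (g u)))"
      unfolding wm_push_pre[OF y] sum_distrib_left by (intro sum.cong refl) (simp only: g(3) mult.assoc)
    also have "\<dots> \<le> (\<Sum>u\<in>?U. f n (g u))" by (intro sum_mono f_le(2)[OF n] g(1))
    finally show ?thesis by (simp add: sum.reindex[OF inj])
  qed
  ultimately show ?thesis by blast
qed

text \<open>The two estimates of the separated sums agree up to a factor independent of
  \<open>n\<close>, so \<open>pressure_eps\<close> takes the same value for all
  \<open>\<epsilon>\<close> between 0 and 1, and the limit at 0 is that of a constant.\<close>

lemma rel_pressure_eq:
  assumes y: "y \<in> fullshift l"
  shows "rel_pressure k \<pi> f y = P + limavg (\<lambda>n. ln (wm \<nu> (pre n y)))"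
proof -
  let ?Z = "fullshift k \<inter> \<pi> -` {y}"
  let ?a = "\<lambda>n. ln (wm \<nu> (pre n y))"
  have eps: "pressure_eps f ?Z \<epsilon> = ereal (P + limavg ?a)" if \<epsilon>: "0 < \<epsilon>" "\<epsilon> < 1" for \<epsilon>
  proof -
    obtain j where j: "(1/2) ^ j < \<epsilon>" using real_arch_pow_inv[of \<epsilon> "1/2"] \<epsilon> by auto
    define D where "D = K + C + quasi_bernoulli.K k \<mu> C * real j"
    let ?S = "\<lambda>n. Sup (sep_sums y \<epsilon> n)"
    have est: "norm (ln (?S n) / real n - ?a n / real n - P) \<le> (\<bar>D\<bar> + \<bar>K\<bar>) / real n" if n: "1 \<le> n" for n
    proof -
      let ?v = "exp (real n * P) * wm \<nu> (pre n y)"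
      have v: "0 < wm \<nu> (pre n y)" by (rule \<nu>.pre_pos[OF y])
      obtain s where s: "s \<in> sep_sums y \<epsilon> n" "exp (- K) * ?v \<le> s" using sep_sums_lower[OF y n \<epsilon>(2)] by blast
      have up: "t \<le> exp D * ?v" if "t \<in> sep_sums y \<epsilon> n" for t
        unfolding D_def by (rule sep_sums_upper[OF y n less_imp_le[OF j] that])
      then have "?S n \<le> exp D * ?v" using s(1) by (intro cSup_least) auto
      moreover have "s \<le> ?S n" using up by (intro cSup_upper s(1) bdd_aboveI)
      then have lo: "exp (- K) * ?v \<le> ?S n" using s(2) by linarith
      moreover have "0 < exp (- K) * ?v" using v by simp
      ultimately have "0 < ?S n" "ln (?S n) \<le> ln (exp D * ?v)" "ln (exp (- K) * ?v) \<le> ln (?S n)"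
        by (auto simp only: ln_le_cancel_iff)
      then have "\<bar>ln (?S n) - ?a n - real n * P\<bar> \<le> \<bar>D\<bar> + \<bar>K\<bar>"
        using v by (simp add: ln_mult)
      moreover have "ln (?S n) / real n - ?a n / real n - P = (ln (?S n) - ?a n - real n * P) / real n"
        using n by (simp add: diff_divide_distrib)
      ultimately show ?thesis by (simp add: divide_right_mono)
    qed
    have "(\<lambda>n. ln (?S n) / real n - ?a n / real n) \<longlonglongrightarrow> P"
    proof (rule LIM_zero_cancel, rule Lim_null_comparison)
      show "\<forall>\<^sub>F n in sequentially. norm (ln (?S n) / real n - ?a n / real n - P) \<le> (\<bar>D\<bar> + \<bar>K\<bar>) / real n"
        by (rule eventually_sequentiallyI[of 1]) (rule est)
      show "(\<lambda>n. (\<bar>D\<bar> + \<bar>K\<bar>) / real n) \<longlonglongrightarrow> 0" by (rule lim_const_over_n)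
    qed
    then have S: "limsup (\<lambda>n. ereal (ln (?S n) / real n)) = ereal P + limsup (\<lambda>n. ereal (?a n / real n))"
      by (rule limavg_asymp)
    have a: "ereal (limavg ?a) = limsup (\<lambda>n. ereal (?a n / real n))"
    proof (rule limavg_finite)
      show "\<bar>?a n\<bar> \<le> quasi_bernoulli.K l \<nu> C * real n" for n by (rule \<nu>.lw_bound[OF y])
      from this[of 1] show "0 \<le> quasi_bernoulli.K l \<nu> C" by simp
    qed
    show ?thesis unfolding pressure_eps_def sep_sums_def[symmetric] S a[symmetric] by simp
  qed
  have "Lim (at_right 0) (pressure_eps f ?Z) = ereal (P + limavg ?a)"
  proof (rule tendsto_Lim)
    have "\<forall>\<^sub>F \<epsilon> in at_right 0. pressure_eps f ?Z \<epsilon> = ereal (P + limavg ?a)"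
      by (rule eventually_at_rightI[of 0 1]) (auto intro: eps)
    then show "(pressure_eps f ?Z \<longlongrightarrow> ereal (P + limavg ?a)) (at_right 0)"
      by (rule tendsto_eventually)
  qed simp
  then show ?thesis by (simp add: rel_pressure_def sep_pressure_def)
qed

section \<open>The two equilibrium statements\<close>

lemma integral_rel_pressure:
  assumes m: "m \<in> inv_measures l"
  shows "(\<integral>y. rel_pressure k \<pi> f y \<partial>m) = P + (\<integral>y. limavg (\<lambda>n. ln (wm \<nu> (pre n y))) \<partial>m)"
proof -
  interpret m: shift_inv l m by unfold_locales (rule m)
  interpret c: almost_additive_cocycle m shift "\<lambda>n y. ln (wm \<nu> (pre n y))" C "quasi_bernoulli.K l \<nu> C"
    by (rule \<nu>.lw_cocycle[OF m.shift_inv_axioms])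
  have "(\<integral>y. rel_pressure k \<pi> f y \<partial>m) = (\<integral>y. P + c.ulim y \<partial>m)"
    by (rule Bochner_Integration.integral_cong) (auto simp: rel_pressure_eq c.ulim_def)
  also have "\<dots> = P + (\<integral>y. c.ulim y \<partial>m)" using c.integrable_ulim m.prob_space by simp
  finally show ?thesis by (simp add: c.ulim_def)
qed

text \<open>The quantity to be maximised is \<open>P\<close> plus the expression of the variational
  principle for \<nu>, which is nonpositive and vanishes exactly at \<nu>.\<close>

lemma push_equilibrium: "is_unique_equilibrium l (rel_pressure k \<pi> f) \<nu>"
proof -
  let ?F = "\<lambda>m. ks_entropy m shift + (\<integral>y. rel_pressure k \<pi> f y \<partial>m)"
  have le: "?F m \<le> P" and eq: "?F m = P \<longleftrightarrow> m = \<nu>" if m: "m \<in> inv_measures l" for m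
    using \<nu>.variational(2,3)[OF m] by (auto simp: integral_rel_pressure[OF m])
  have top: "?F \<nu> = P" using eq[OF push_inv] by simp
  show ?thesis unfolding is_unique_equilibrium_def top using push_inv le eq by blast
qed

text \<open>Replacing \<open>f n\<close> by \<open>exp (n P)\<close> times the cylinder mass moves
  the averaged integral by at most \<open>K / n\<close>, hence not its limit.\<close>

lemma rel_free_energy_eq:
  assumes m: "m \<in> inv_measures k"
  shows "rel_free_energy f \<nu> m
    = ks_entropy m shift + (\<integral>x. limavg (\<lambda>n. ln (wm \<mu> (pre n x))) \<partial>m) + (P - ks_entropy \<nu> shift)"
proof -
  interpret m: shift_inv k m by unfold_locales (rule m)
  let ?a = "\<lambda>n x. ln (wm \<mu> (pre n x))"
  interpret c: almost_additive_cocycle m shift ?a C "quasi_bernoulli.K k \<mu> C"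
    by (rule lw_cocycle[OF m.shift_inv_axioms])
  have est: "norm ((\<integral>x. ln (f n x) \<partial>m) / real n - (\<integral>x. ?a n x \<partial>m) / real n - P) \<le> K / real n" if n: "1 \<le> n" for n
  proof -
    have "f n \<in> borel_measurable (shift_space k)"
      unfolding shift_space_def by (rule borel_measurable_continuous_on_restrict[OF cont[OF n]])
    then have "f n \<in> borel_measurable m" using measurable_cong_sets[OF m.sets_M refl] by blast
    then have lf: "(\<lambda>x. ln (f n x)) \<in> borel_measurable m" by measurable
    have i: "integrable m (\<lambda>x. ln (f n x))"
    proof (rule c.integrable_bounded[OF lf])
      fix x assume "x \<in> space m"
      then show "\<bar>ln (f n x)\<bar> \<le> K + \<bar>real n * P\<bar> + quasi_bernoulli.K k \<mu> C * real n"
        using compare[OF n, of x] c.bd[of x n] by (auto simp: abs_le_iff)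
    qed
    have "(\<integral>x. ln (f n x) \<partial>m) - real n * P - (\<integral>x. ?a n x \<partial>m) = (\<integral>x. ln (f n x) - real n * P - ?a n x \<partial>m)"
      using i c.integrable_a[of n] m.prob_space by simp
    also have "\<bar>\<dots>\<bar> \<le> (\<integral>x. \<bar>ln (f n x) - real n * P - ?a n x\<bar> \<partial>m)"
      by (rule integral_abs_bound)
    also have "\<dots> \<le> (\<integral>x. K \<partial>m)"
    proof (rule integral_mono)
      show "integrable m (\<lambda>x. \<bar>ln (f n x) - real n * P - ?a n x\<bar>)" using i c.integrable_a[of n] by auto
    qed (use compare[OF n] in auto)
    finally have "\<bar>(\<integral>x. ln (f n x) \<partial>m) - real n * P - (\<integral>x. ?a n x \<partial>m)\<bar> \<le> K" using m.prob_space by simp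
    moreover have "(\<integral>x. ln (f n x) \<partial>m) / real n - (\<integral>x. ?a n x \<partial>m) / real n - P
        = ((\<integral>x. ln (f n x) \<partial>m) - real n * P - (\<integral>x. ?a n x \<partial>m)) / real n"
      using n by (simp add: diff_divide_distrib)
    ultimately show ?thesis by (simp add: divide_right_mono)
  qed
  have "(\<lambda>n. (\<integral>x. ln (f n x) \<partial>m) / real n - (\<integral>x. ?a n x \<partial>m) / real n) \<longlonglongrightarrow> P"
  proof (rule LIM_zero_cancel, rule Lim_null_comparison)
    show "\<forall>\<^sub>F n in sequentially. norm ((\<integral>x. ln (f n x) \<partial>m) / real n - (\<integral>x. ?a n x \<partial>m) / real n - P) \<le> K / real n"
      by (rule eventually_sequentiallyI[of 1]) (rule est)
    show "(\<lambda>n. K / real n) \<longlonglongrightarrow> 0" by (rule lim_const_over_n)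
  qed
  from tendsto_add[OF this variational(1)[OF m]]
  have "(\<lambda>n. (\<integral>x. ln (f n x) \<partial>m) / real n) \<longlonglongrightarrow> P + (\<integral>x. limavg (\<lambda>n. ?a n x) \<partial>m)" by simp
  then show ?thesis unfolding rel_free_energy_def by (simp add: limI)
qed

text \<open>With the entropy of \<nu> a constant, the variational principle on \<open>X\<close>
  yields the upper bound \<open>?c\<close>, attained exactly at \<mu>.\<close>

lemma rel_equilibrium: "is_unique_rel_equilibrium k l \<pi> f \<nu> \<mu>"
proof -
  let ?c = "P - ks_entropy \<nu> shift"
  have le: "rel_free_energy f \<nu> m \<le> ?c" and eq: "rel_free_energy f \<nu> m = ?c \<longleftrightarrow> m = \<mu>"
    if m: "m \<in> inv_measures k" for m
    using variational(2,3)[OF m] by (auto simp: rel_free_energy_eq[OF m])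
  have top: "rel_free_energy f \<nu> \<mu> = ?c" using eq[OF inv] by simp
  show ?thesis unfolding is_unique_rel_equilibrium_def top using inv le eq by blast
qed

end

theorem theorem4p8:
  fixes k l :: nat
    and \<pi> :: "(nat \<Rightarrow> nat) \<Rightarrow> (nat \<Rightarrow> nat)"
    and f :: "nat \<Rightarrow> (nat \<Rightarrow> nat) \<Rightarrow> real"
    and \<mu> :: "(nat \<Rightarrow> nat) measure"
  assumes "k \<ge> 1" and "l \<ge> 1"
    and "one_block_factor k l \<pi>"
    and "almost_additive k f" and "bounded_variation k f"
    and "\<mu> \<in> inv_measures k" and "gibbs k f \<mu>"
    and "\<forall>\<mu>'\<in>inv_measures k. gibbs k f \<mu>' \<longrightarrow> \<mu>' = \<mu>"
  shows "is_unique_equilibrium l (rel_pressure k \<pi> f) (push l \<pi> \<mu>) \<and>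
         is_unique_rel_equilibrium k l \<pi> f (push l \<pi> \<mu>) \<mu>"
proof -
  obtain C K where sys: "gibbs_system k f \<mu> (top_pressure k f) C K"
    using gibbs_system_of_gibbs assms(1,4,6,7) by blast
  obtain p where p: "\<forall>x\<in>fullshift k. \<forall>i. \<pi> x i = p (x i)"
    using assms(3) by (auto simp: one_block_factor_def)
  have "\<exists>a. a < k \<and> p a = b" if "b < l" for b
  proof -
    \<comment> \<open>Surjectivity on letters follows from surjectivity on points: a preimage of the
      constant point \<open>b\<close> starts with a letter over \<open>b\<close>.\<close>
    have "(\<lambda>_. b) \<in> \<pi> ` fullshift k" using assms(3) that by (auto simp: one_block_factor_def fullshift_def)
    then obtain x where x: "x \<in> fullshift k" "\<pi> x = (\<lambda>_. b)" by auto
    then have "p (x 0) = b" using p by metis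
    then show ?thesis using x(1) by (auto simp: fullshift_def)
  qed
  then obtain q where q: "\<And>b. b < l \<Longrightarrow> q b < k \<and> p (q b) = b" by metis
  interpret gibbs_factor k f \<mu> "top_pressure k f" C K l \<pi> p q
    using sys by (rule gibbs_factor.intro) (unfold_locales, use assms(3) p q in auto)
  show ?thesis using push_equilibrium rel_equilibrium by blast
qed

end
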